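(* Every generic real globally balanced graph (generic real GB-graph) is locally balanced.
   Context: Generic real GB-graph of degree $d\ge2$: take $2d-2$ distinct points on $\overline{\mathbb{R}}=\mathbb{R}\cup\{\infty\}\subset\overline{\mathbb{C}}$ and a perfect matching of these points such that matched points can be joined by pairwise non-intersecting arcs in the open upper half-plane. The graph $\Gamma\subset\overline{\mathbb{C}}$ has these $2d-2$ points as vertices, and its edges are the $2d-2$ segments of $\overline{\mathbb{R}}$ between consecutive points, the $d-1$ arcs in the upper half-plane joining matched points, and the reflections of these arcs in $\overline{\mathbb{R}}$. All vertices have degree 4, there are $2d$ faces, and by symmetry an alternating 2-coloring of the faces has $d$ faces of each color, so $\Gamma$ is globally balanced. Local balance. Let $\Gamma\subset S$ be a globally balanced graph with an alternating $A$-$B$ face coloring (faces adjacent along an edge have different colors), with edges oriented so that $A$-faces lie on their left. A cycle of $\Gamma$ is a concatenation of edges forming a simple closed curve; it is positive if it keeps only $A$-faces on its left side. A collection $L=\{\gamma_1,\dots,\gamma_k\}$ of pairwise disjoint cycles is a cobordant multicycle if $S-\bigcup_n\gamma_n$ is disconnected and has a connected component $R$ with $\partial R=\bigsqcup_{n}\gamma_n$; it is positive if every $\gamma_n$ is positive, and its interior is then the connected component $R$ of $S-\bigcup_n\gamma_n$ with $\partial R=\bigsqcup_{n}\gamma_n$ lying on the left of the cycles (containing the $A$-faces incident to them). $\Gamma$ is locally balanced if for every positive cobordant multicycle the number of $A$-faces in its interior is strictly greater than the number of $B$-faces in its interior. (Here $S=\overline{\mathbb{C}}$.) *)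

theory Defs
  imports "HOL-Complex_Analysis.Complex_Analysis" "HOL-Library.Disjoint_Sets"
begin

section \<open>The Riemann sphere\<close>

text \<open>The Riemann sphere is the one-point compactification of the complex plane; \<^term>\<open>None\<close> is
  the point at infinity.\<close>

definition riemann_sphere :: "complex option topology" where
  "riemann_sphere = Alexandroff_compactification euclidean"

definition extended_reals :: "complex option set" where
  "extended_reals = insert None (Some ` \<real>)"

definition upper_half_plane :: "complex option set" where
  "upper_half_plane = Some ` {z. 0 < Im z}"

definition reflect :: "complex option \<Rightarrow> complex option" where
  "reflect = map_option cnj"

definition sphere_arc :: "(real \<Rightarrow> complex option) \<Rightarrow> bool" where
  "sphere_arc g \<longleftrightarrow> pathin riemann_sphere g \<and> inj_on g {0..1}"

definition simple_closed_curve :: "(real \<Rightarrow> complex option) \<Rightarrow> bool" where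
  "simple_closed_curve \<gamma> \<longleftrightarrow> pathin riemann_sphere \<gamma> \<and> inj_on \<gamma> {0..<1} \<and> \<gamma> 0 = \<gamma> 1"

abbreviation curve_image :: "(real \<Rightarrow> complex option) \<Rightarrow> complex option set" where
  "curve_image g \<equiv> g ` {0..1}"

abbreviation complement_components :: "complex option set \<Rightarrow> complex option set set" where
  "complement_components K \<equiv>
     connected_components_of (subtopology riemann_sphere (topspace riemann_sphere - K))"

text \<open>The Moebius transformation sending \<open>a\<close> to zero and \<open>b\<close> to infinity.\<close>

definition moebius_quotient :: "complex \<Rightarrow> complex \<Rightarrow> complex option \<Rightarrow> complex" where
  "moebius_quotient a b p = (case p of None \<Rightarrow> 1 | Some z \<Rightarrow> (z - a) / (z - b))"

text \<open>The left side of an oriented simple closed curve is one of the two components of its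
  complement.  If \<open>a\<close> lies in the component \<open>C\<close> and \<open>b\<close> in the other one, the orientation preserving
  map above turns the curve into a loop in the plane around the origin, and \<open>C\<close> is on the left
  precisely when this loop runs counterclockwise.\<close>

definition left_side :: "(real \<Rightarrow> complex option) \<Rightarrow> complex option set" where
  "left_side \<gamma> = \<Union>{C \<in> complement_components (curve_image \<gamma>).
     \<forall>a b. Some a \<in> C \<and> Some b \<notin> C \<union> curve_image \<gamma> \<longrightarrow>
       winding_number (moebius_quotient a b \<circ> \<gamma>) 0 = 1}"

section \<open>Embedded graphs and local balance\<close>

text \<open>An embedded graph is given by the set \<open>E\<close> of its closed edges.\<close>

definition faces :: "complex option set set \<Rightarrow> complex option set set" where
  "faces E = complement_components (\<Union>E)"

definition incident :: "complex option set \<Rightarrow> complex option set \<Rightarrow> bool" where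
  "incident f e \<longleftrightarrow> e \<subseteq> riemann_sphere frontier_of f"

text \<open>The coloring is represented by the set \<open>A\<close> of \<open>A\<close>-faces; all other faces are \<open>B\<close>-faces.\<close>

definition alternating_coloring ::
    "complex option set set \<Rightarrow> complex option set set \<Rightarrow> bool" where
  "alternating_coloring E A \<longleftrightarrow> A \<subseteq> faces E \<and>
     (\<forall>e\<in>E. \<forall>f\<in>faces E. \<forall>g\<in>faces E.
        f \<noteq> g \<and> incident f e \<and> incident g e \<longrightarrow> (f \<in> A \<longleftrightarrow> g \<notin> A))"

definition cycle :: "complex option set set \<Rightarrow> (real \<Rightarrow> complex option) \<Rightarrow> bool" where
  "cycle E \<gamma> \<longleftrightarrow> simple_closed_curve \<gamma> \<and> (\<exists>E'\<subseteq>E. curve_image \<gamma> = \<Union>E')"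

text \<open>Positivity concerns the faces meeting the cycle along an edge: at a vertex of the cycle a
  \<open>B\<close>-face may well touch it from the left.\<close>

definition positive_cycle ::
    "complex option set set \<Rightarrow> complex option set set \<Rightarrow> (real \<Rightarrow> complex option) \<Rightarrow> bool" where
  "positive_cycle E A \<gamma> \<longleftrightarrow> cycle E \<gamma> \<and>
     (\<forall>e\<in>E. \<forall>f\<in>faces E. e \<subseteq> curve_image \<gamma> \<and> incident f e \<and> f \<subseteq> left_side \<gamma> \<longrightarrow> f \<in> A)"

definition cobounds :: "(real \<Rightarrow> complex option) set \<Rightarrow> complex option set \<Rightarrow> bool" where
  "cobounds L R \<longleftrightarrow> R \<in> complement_components (\<Union>\<gamma>\<in>L. curve_image \<gamma>) \<and>
     riemann_sphere frontier_of R = (\<Union>\<gamma>\<in>L. curve_image \<gamma>)"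

definition cobordant_multicycle ::
    "complex option set set \<Rightarrow> (real \<Rightarrow> complex option) set \<Rightarrow> bool" where
  "cobordant_multicycle E L \<longleftrightarrow> finite L \<and> (\<forall>\<gamma>\<in>L. cycle E \<gamma>) \<and> disjoint_family_on curve_image L \<and>
     \<not> connected_space
         (subtopology riemann_sphere (topspace riemann_sphere - (\<Union>\<gamma>\<in>L. curve_image \<gamma>))) \<and>
     (\<exists>R. cobounds L R)"

definition positive_cobordant_multicycle ::
    "complex option set set \<Rightarrow> complex option set set \<Rightarrow> (real \<Rightarrow> complex option) set \<Rightarrow> bool" where
  "positive_cobordant_multicycle E A L \<longleftrightarrow>
     cobordant_multicycle E L \<and> (\<forall>\<gamma>\<in>L. positive_cycle E A \<gamma>)"

definition multicycle_interior ::
    "(real \<Rightarrow> complex option) set \<Rightarrow> complex option set \<Rightarrow> bool" where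
  "multicycle_interior L R \<longleftrightarrow> cobounds L R \<and> (\<forall>\<gamma>\<in>L. R \<subseteq> left_side \<gamma>)"

definition locally_balanced ::
    "complex option set set \<Rightarrow> complex option set set \<Rightarrow> bool" where
  "locally_balanced E A \<longleftrightarrow>
     (\<forall>L R. positive_cobordant_multicycle E A L \<and> multicycle_interior L R \<longrightarrow>
        card {f \<in> faces E - A. f \<subseteq> R} < card {f \<in> faces E \<inter> A. f \<subseteq> R})"

section \<open>Generic real GB-graphs\<close>

definition perfect_matching :: "'a set \<Rightarrow> 'a set set \<Rightarrow> bool" where
  "perfect_matching V M \<longleftrightarrow> partition_on V M \<and> (\<forall>m\<in>M. card m = 2)"

definition real_segments :: "complex option set \<Rightarrow> complex option set set" where
  "real_segments V = {curve_image g | g. sphere_arc g \<and> curve_image g \<subseteq> extended_reals \<and>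
     g 0 \<in> V \<and> g 1 \<in> V \<and> g ` {0<..<1} \<inter> V = {}}"

definition upper_arc :: "complex option set \<Rightarrow> complex option set \<Rightarrow> bool" where
  "upper_arc m e \<longleftrightarrow> (\<exists>g. sphere_arc g \<and> {g 0, g 1} = m \<and>
     g ` {0<..<1} \<subseteq> upper_half_plane \<and> e = curve_image g)"

definition generic_real_GB_graph ::
    "nat \<Rightarrow> complex option set \<Rightarrow> complex option set set \<Rightarrow> bool" where
  "generic_real_GB_graph d V E \<longleftrightarrow>
     2 \<le> d \<and> V \<subseteq> extended_reals \<and> finite V \<and> card V = 2 * d - 2 \<and>
     (\<exists>M \<alpha>. perfect_matching V M \<and> (\<forall>m\<in>M. upper_arc m (\<alpha> m)) \<and> disjoint_family_on \<alpha> M \<and>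
        E = real_segments V \<union> \<alpha> ` M \<union> (\<lambda>m. reflect ` \<alpha> m) ` M)"

end

theory Submission
  imports Defs
begin

text \<open>
  Reflection in the extended real line exchanges the two colors, since every face has a real segment
  on its frontier and the face on the other side of that segment is its mirror image.  Let \<open>R\<close> be the
  interior of a positive multicycle.  A \<open>B\<close>-face in \<open>R\<close> has no edge of a cycle on its frontier, so its
  mirror image lies in \<open>R\<close> as well; hence reflection injects the \<open>B\<close>-faces of \<open>R\<close> into the \<open>A\<close>-faces of \<open>R\<close>.

  If this injection were onto, take one of the cycles.  If it contains a real segment, both faces
  along that segment lie in \<open>R\<close>, contradicting the Jordan curve theorem.  Otherwise it consists of
  an arc and its mirror image; a face in \<open>R\<close> along the arc and its mirror image along the reflected arc are then both
  \<open>A\<close>-faces, although they have different colors.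
\<close>

section \<open>Topology of the Riemann sphere\<close>

text \<open>The upper edges are arbitrary topological arcs, so at a point of such an edge there is
  no local notion of its two sides. On the real line a small disc is cut into two half discs, and a
  face touching one non-vertex point of a segment therefore touches all of it. Along an upper arc a
  face might a priori fill a neighbourhood of a point except for the arc itself. Janiszewski's
  theorem shows that this is the only alternative to touching the whole arc, and the Jordan curve
  theorem rules it out for an arc on a cycle: an open set disjoint from \<open>R\<close> accumulates
  at every point of the cycle. Janiszewski's theorem also shows that disjoint arcs do not separate
  the sphere, which is what brings every face to the real line.

  Infinity may be a vertex or an inner point of a segment, whereas these theorems concern the plane.
  They are applied in a chart that omits a finite point off the curves, so that infinity becomes an
  ordinary point.\<close>

lemma topspace_riemann_sphere [simp]: "topspace riemann_sphere = UNIV"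
proof -
  have "x \<in> topspace riemann_sphere" for x
    by (cases x) (auto simp: riemann_sphere_def)
  then show ?thesis by blast
qed

text \<open>One criterion for both kinds of open sets of the compactification: a neighbourhood of
  infinity has compact complement in the plane, and closedness of that complement is already the
  openness of the finite part.\<close>

lemma openin_riemann_sphere:
  "openin riemann_sphere V \<longleftrightarrow> open (Some -` V) \<and> (None \<in> V \<longrightarrow> bounded (- (Some -` V)))"
proof
  assume "openin riemann_sphere V"
  then consider U where "open U" "V = Some ` U"
    | C where "compact C" "V = insert None (Some ` (UNIV - C))"
    unfolding riemann_sphere_def openin_Alexandroff_compactification by auto
  then show "open (Some -` V) \<and> (None \<in> V \<longrightarrow> bounded (- (Some -` V)))"
  proof cases
    case 1
    then have "Some -` V = U" by auto
    with 1 show ?thesis by auto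
  next
    case 2
    then have "Some -` V = - C" by auto
    with 2 show ?thesis by (simp add: compact_imp_bounded compact_imp_closed open_Compl)
  qed
next
  assume *: "open (Some -` V) \<and> (None \<in> V \<longrightarrow> bounded (- (Some -` V)))"
  show "openin riemann_sphere V"
  proof (cases "None \<in> V")
    case True
    have "x \<in> insert None (Some ` (Some -` V)) \<longleftrightarrow> x \<in> V" for x
      using True by (cases x) auto
    then have "V = insert None (Some ` (UNIV - - (Some -` V)))"
      by (simp add: set_eq_iff Compl_eq_Diff_UNIV double_diff)
    moreover have "compact (- (Some -` V))"
      using * True by (simp add: compact_eq_bounded_closed closed_Compl)
    ultimately show ?thesis
      unfolding riemann_sphere_def openin_Alexandroff_compactification
      by (metis closedin_closed_eq closed_UNIV compact_imp_closed closed_closedin compactin_euclidean_iff topspace_euclidean)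
  next
    case False
    have "x \<in> Some ` (Some -` V) \<longleftrightarrow> x \<in> V" for x
      using False by (cases x) auto
    then have "V = Some ` (Some -` V)" by blast
    with * show ?thesis
      unfolding riemann_sphere_def openin_Alexandroff_compactification
      by (metis open_openin)
  qed
qed

lemma openin_Some_image: "open U \<Longrightarrow> openin riemann_sphere (Some ` U)"
  by (simp add: openin_riemann_sphere inj_vimage_image_eq image_iff)

lemma Hausdorff_riemann_sphere: "Hausdorff_space riemann_sphere"
  unfolding riemann_sphere_def Hausdorff_space_Alexandroff_compactification
  by (simp add: Hausdorff_space_euclidean locally_compact_space_euclidean)

lemma continuous_map_Some: "continuous_map euclidean riemann_sphere Some"
  by (simp add: riemann_sphere_def Urysohn.continuous_map_Some)

lemma continuous_map_the:
  "continuous_map (subtopology riemann_sphere (- {None})) euclidean the"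
  unfolding continuous_map_def
proof (intro conjI allI impI)
  fix U :: "complex set" assume "openin euclidean U"
  then have "openin riemann_sphere (Some ` U)" by (simp add: openin_Some_image)
  moreover have "{x \<in> topspace (subtopology riemann_sphere (- {None})). the x \<in> U} = Some ` U \<inter> - {None}"
    by (auto simp: image_iff)
  ultimately show "openin (subtopology riemann_sphere (- {None}))
      {x \<in> topspace (subtopology riemann_sphere (- {None})). the x \<in> U}"
    by (auto simp: openin_subtopology)
qed auto

section \<open>Inversions exchanging infinity with a finite point, and the charts they give\<close>

definition sphere_inversion :: "complex \<Rightarrow> complex option \<Rightarrow> complex option" where
  "sphere_inversion q p =
     (case p of None \<Rightarrow> Some q | Some z \<Rightarrow> if z = q then None else Some (q + 1 / (z - q)))"

lemma sphere_inversion_simps [simp]: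
  "sphere_inversion q None = Some q"
  "sphere_inversion q (Some q) = None"
  "sphere_inversion q (sphere_inversion q p) = p"
  by (auto simp: sphere_inversion_def split: option.splits)

lemma sphere_inversion_Some:
  "z \<noteq> q \<Longrightarrow> sphere_inversion q (Some z) = Some (q + 1 / (z - q))"
  by (simp add: sphere_inversion_def)

lemma sphere_inversion_eq_iff [simp]:
  "sphere_inversion q p = sphere_inversion q p' \<longleftrightarrow> p = p'"
  by (metis sphere_inversion_simps(3))

lemma sphere_inversion_eq_None [simp]: "sphere_inversion q p = None \<longleftrightarrow> p = Some q"
  by (metis sphere_inversion_simps(2) sphere_inversion_simps(3))

lemma sphere_inversion_eq_Some [simp]: "sphere_inversion q p = Some q \<longleftrightarrow> p = None"
  by (metis sphere_inversion_simps(1) sphere_inversion_simps(3))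

lemma sphere_inversion_vimage: "sphere_inversion q -` S = sphere_inversion q ` S"
  by (auto simp: image_iff) (metis sphere_inversion_simps(3))+

lemma openin_sphere_inversion_vimage:
  assumes "openin riemann_sphere V"
  shows "openin riemann_sphere (sphere_inversion q -` V)"
  unfolding openin_riemann_sphere
proof (intro conjI impI)
  let ?V = "Some -` V" and ?W = "Some -` sphere_inversion q -` V"
  have V: "open ?V" "None \<in> V \<Longrightarrow> bounded (- ?V)"
    using assms by (auto simp: openin_riemann_sphere)
  have W: "?W = {z. z \<noteq> q \<and> q + 1 / (z - q) \<in> ?V} \<union> (if None \<in> V then {q} else {})"
  proof (rule set_eqI)
    fix z show "z \<in> ?W \<longleftrightarrow> z \<in> {z. z \<noteq> q \<and> q + 1 / (z - q) \<in> ?V} \<union> (if None \<in> V then {q} else {})"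
      by (cases "z = q") (simp_all add: sphere_inversion_Some)
  qed
  have op: "open {z. z \<noteq> q \<and> q + 1 / (z - q) \<in> ?V}"
  proof -
    have "continuous_on (- {q}) (\<lambda>z. q + 1 / (z - q))"
      by (intro continuous_intros) auto
    then have "open ((\<lambda>z. q + 1 / (z - q)) -` ?V \<inter> - {q})"
      using V(1) by (subst (asm) continuous_on_open_vimage) auto
    then show ?thesis
      by (simp add: vimage_def Int_def conj_commute)
  qed
  show "open ?W"
  proof (cases "None \<in> V")
    case True
    obtain B where B: "0 < B" "\<And>w. w \<notin> ?V \<Longrightarrow> norm w \<le> B"
      using V(2)[OF True] by (meson ComplI bounded_pos)
    \<comment> \<open>For \<open>z\<close> other than \<open>q\<close> within \<open>e\<close> of
      \<open>q\<close> the reciprocal has norm above \<open>B + norm q + 1\<close>. Adding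
      \<open>q\<close> costs at most \<open>norm q\<close>, so the value stays outside the ball of
      radius \<open>B\<close> that contains the complement of \<open>?V\<close>.\<close>
    define e where "e = 1 / (B + norm q + 1)"
    have "0 < e" using B(1) by (simp add: e_def add_pos_nonneg)
    have "z \<in> ?W" if "z \<in> ball q e" for z
    proof (cases "z = q")
      case False
      have "norm (z - q) < e" using that by (simp add: dist_norm norm_minus_commute)
      moreover have "0 < B + norm q + 1" using B(1) by (simp add: add_pos_nonneg)
      ultimately have "B + norm q + 1 < norm (1 / (z - q))"
        using False by (simp add: e_def norm_divide pos_less_divide_eq mult.commute)
      moreover have "norm (1 / (z - q)) \<le> norm (q + 1 / (z - q)) + norm q"
        by (metis add_diff_cancel_left' norm_triangle_ineq4)
      ultimately have "B < norm (q + 1 / (z - q))" by linarith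
      then have "q + 1 / (z - q) \<in> ?V" using B(2) by (meson not_le)
      then show ?thesis using False by (simp add: sphere_inversion_Some)
    qed (use True in simp)
    then have "ball q e \<subseteq> ?W" by blast
    \<comment> \<open>The set in \<open>op\<close> is \<open>?W\<close> without the point
      \<open>q\<close>; filling the puncture with a ball keeps it open.\<close>
    then have "?W = {z. z \<noteq> q \<and> q + 1 / (z - q) \<in> ?V} \<union> ball q e"
      unfolding W using \<open>0 < e\<close> True by auto
    with open_Un[OF op open_ball[of q e]] show ?thesis by simp
  qed (use op W in simp)
  show "bounded (- ?W)" if "None \<in> sphere_inversion q -` V"
  proof -
    have "q \<in> ?V" using that by simp
    then obtain e where e: "e > 0" "ball q e \<subseteq> ?V" using V(1) open_contains_ball by blast
    have "norm z \<le> norm q + 1 / e" if "z \<notin> ?W" for z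
    proof (cases "z = q")
      case False
      then have "q + 1 / (z - q) \<notin> ball q e" using that e(2) by (auto simp: sphere_inversion_Some)
      then have "e \<le> norm (1 / (z - q))" by (simp add: dist_norm)
      then have "norm (z - q) \<le> 1 / e"
        using e(1) False by (simp add: norm_divide pos_le_divide_eq mult.commute)
      then show ?thesis using norm_triangle_sub[of z q] by linarith
    qed (use e in simp)
    then show ?thesis by (meson ComplD boundedI)
  qed
qed

lemma continuous_map_sphere_inversion:
  "continuous_map riemann_sphere riemann_sphere (sphere_inversion q)"
  using openin_sphere_inversion_vimage
  by (auto simp: continuous_map_def vimage_def)

lemma openin_sphere_inversion_image:
  "openin riemann_sphere V \<Longrightarrow> openin riemann_sphere (sphere_inversion q ` V)"
  by (metis openin_sphere_inversion_vimage sphere_inversion_vimage)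

text \<open>A planar coordinate on the sphere without \<open>Some q\<close>, in which infinity has
  the coordinate \<open>q\<close>. Planar theorems thus apply to curves through infinity as soon as
  they avoid one finite point.\<close>

definition chart :: "complex \<Rightarrow> complex \<Rightarrow> complex option" where
  "chart q w = sphere_inversion q (Some w)"

lemma inj_chart: "inj (chart q)"
  by (auto simp: inj_def chart_def)

lemma chart_ne [simp]: "chart q w \<noteq> Some q"
  by (simp add: chart_def)

lemma chart_ne' [simp]: "Some q \<noteq> chart q w"
  by (metis chart_ne)

lemma range_chart: "range (chart q) = - {Some q}"
proof -
  have "p \<in> range (chart q)" if "p \<noteq> Some q" for p
  proof -
    have "sphere_inversion q p \<noteq> None" using that by simp
    then obtain w where "sphere_inversion q p = Some w" by blast
    then have "p = chart q w" by (metis chart_def sphere_inversion_simps(3))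
    then show ?thesis by blast
  qed
  then show ?thesis by auto
qed

lemma continuous_map_chart: "continuous_map euclidean riemann_sphere (chart q)"
  using continuous_map_compose[OF continuous_map_Some continuous_map_sphere_inversion]
  by (simp add: chart_def[abs_def] o_def)

lemma openin_chart_image: "open U \<Longrightarrow> openin riemann_sphere (chart q ` U)"
  using openin_sphere_inversion_image[OF openin_Some_image]
  by (simp add: chart_def[abs_def] image_image)

lemma open_chart_vimage: "openin riemann_sphere S \<Longrightarrow> open (chart q -` S)"
  using continuous_map_chart[of q] by (auto simp: continuous_map_def vimage_def)

lemma closed_chart_vimage: "closedin riemann_sphere S \<Longrightarrow> closed (chart q -` S)"
  using open_chart_vimage[of "- S" q]
  by (simp add: closed_def closedin_def Compl_eq_Diff_UNIV vimage_Diff)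

lemma chart_image_vimage: "chart q ` (chart q -` S) = S - {Some q}"
  using range_chart[of q] by (auto simp: image_vimage_eq)

text \<open>Preimages under a map that is both continuous and open commute with closure. Statements
  about frontiers pass between the plane and the sphere in this way.\<close>

lemma closure_chart_vimage: "closure (chart q -` S) = chart q -` (riemann_sphere closure_of S)"
proof (intro set_eqI iffI)
  fix w assume w: "w \<in> closure (chart q -` S)"
  show "w \<in> chart q -` (riemann_sphere closure_of S)"
    unfolding vimage_eq in_closure_of
  proof (intro conjI allI impI)
    fix T assume T: "chart q w \<in> T \<and> openin riemann_sphere T"
    then have "open (chart q -` T)" by (simp add: open_chart_vimage)
    then have "chart q -` T \<inter> chart q -` S \<noteq> {}"
      using w T by (meson IntI disjoint_iff open_Int_closure_eq_empty vimageI2)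
    then show "\<exists>y. y \<in> S \<and> y \<in> T" by auto
  qed simp
next
  fix w assume w: "w \<in> chart q -` (riemann_sphere closure_of S)"
  have "chart q -` S \<inter> U \<noteq> {}" if U: "open U" "w \<in> U" for U
  proof -
    obtain y where "y \<in> S" "y \<in> chart q ` U"
      using w U openin_chart_image[OF U(1), where q = q] unfolding vimage_eq in_closure_of by blast
    then show ?thesis by auto
  qed
  then show "w \<in> closure (chart q -` S)"
    by (meson closure_iff_nhds_not_empty subset_iff disjoint_iff)
qed

lemma frontier_of_riemann_sphere:
  "riemann_sphere frontier_of S = riemann_sphere closure_of S \<inter> riemann_sphere closure_of (- S)"
  by (simp add: frontier_of_closures Compl_eq_Diff_UNIV)

lemma frontier_chart_vimage: "frontier (chart q -` S) = chart q -` (riemann_sphere frontier_of S)"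
  by (simp add: frontier_closures frontier_of_riemann_sphere closure_chart_vimage flip: vimage_Compl)

section \<open>Curves in a chart\<close>

definition lift_curve :: "complex \<Rightarrow> (real \<Rightarrow> complex option) \<Rightarrow> real \<Rightarrow> complex" where
  "lift_curve q g t = the (sphere_inversion q (g t))"

lemma chart_lift_curve: "g t \<noteq> Some q \<Longrightarrow> chart q (lift_curve q g t) = g t"
  by (metis chart_def lift_curve_def option.collapse sphere_inversion_eq_None sphere_inversion_simps(3))

text \<open>Where the curve meets \<open>Some q\<close> the inversion gives \<open>None\<close>,
  whose \<open>the\<close> is unspecified. Avoiding that point keeps the composition in the set on
  which \<open>the\<close> is continuous.\<close>

lemma path_lift_curve:
  assumes "pathin riemann_sphere g" "Some q \<notin> curve_image g"
  shows "path (lift_curve q g)"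
proof -
  have "continuous_map (top_of_set {0..1}) riemann_sphere (sphere_inversion q \<circ> g)"
    using assms(1) continuous_map_compose[OF _ continuous_map_sphere_inversion] by (simp add: pathin_def)
  moreover have "g t \<noteq> Some q" if "t \<in> {0..1}" for t
    using assms(2) that by (metis imageI)
  ultimately have "continuous_map (top_of_set {0..1}) (subtopology riemann_sphere (- {None})) (sphere_inversion q \<circ> g)"
    by (auto simp: continuous_map_in_subtopology)
  from continuous_map_compose[OF this continuous_map_the] show ?thesis
    by (simp add: path_def lift_curve_def[abs_def] o_def)
qed

lemma path_image_lift_curve:
  assumes "Some q \<notin> curve_image g"
  shows "path_image (lift_curve q g) = chart q -` curve_image g"
proof -
  have "chart q (lift_curve q g t) = g t" if "t \<in> {0..1}" for t
    using assms that by (intro chart_lift_curve) (metis imageI)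
  then show ?thesis
    unfolding path_image_def
    by (auto simp: image_iff) (metis atLeastAtMost_iff inj_chart injD)
qed

lemma inj_on_lift_curve:
  assumes "inj_on g T" "Some q \<notin> g ` T"
  shows "inj_on (lift_curve q g) T"
  using assms by (auto simp: inj_on_def) (metis chart_lift_curve image_eqI)

lemma arc_lift_curve:
  assumes "sphere_arc g" "Some q \<notin> curve_image g"
  shows "arc (lift_curve q g)"
  using assms path_lift_curve inj_on_lift_curve by (auto simp: sphere_arc_def arc_def)

lemma simple_loop_lift_curve:
  assumes "simple_closed_curve g" "Some q \<notin> curve_image g"
  shows "simple_path (lift_curve q g)" "pathfinish (lift_curve q g) = pathstart (lift_curve q g)"
proof -
  have i: "inj_on (lift_curve q g) {0..<1}"
    using assms by (intro inj_on_lift_curve) (auto simp: simple_closed_curve_def)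
  have e: "lift_curve q g 0 = lift_curve q g 1"
    using assms by (simp add: simple_closed_curve_def lift_curve_def)
  have "loop_free (lift_curve q g)"
    unfolding loop_free_def
  proof (intro ballI impI)
    fix x y :: real assume *: "x \<in> {0..1}" "y \<in> {0..1}" "lift_curve q g x = lift_curve q g y"
    have "x = y" if "x < 1" "y < 1" using i that * by (auto simp: inj_on_def)
    moreover have "x = 0" if "x < 1" "y = 1" using i that * e by (auto simp: inj_on_def)
    moreover have "y = 0" if "y < 1" "x = 1" using i that * e by (auto simp: inj_on_def)
    ultimately show "x = y \<or> x = 0 \<and> y = 1 \<or> x = 1 \<and> y = 0"
      using * by fastforce
  qed
  then show "simple_path (lift_curve q g)"
    using assms path_lift_curve by (auto simp: simple_path_def simple_closed_curve_def)
  show "pathfinish (lift_curve q g) = pathstart (lift_curve q g)"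
    using e by (simp add: pathfinish_def pathstart_def)
qed

lemma closedin_curve_image:
  assumes "pathin riemann_sphere g"
  shows "closedin riemann_sphere (curve_image g)"
proof -
  have "compactin riemann_sphere (g ` {0..1})"
    using assms unfolding pathin_def
    by (intro image_compactin[of "top_of_set {0..1}"])
       (auto simp: compactin_subtopology)
  then show ?thesis
    by (rule compactin_imp_closedin[OF Hausdorff_riemann_sphere])
qed

lemma connectedin_curve_image:
  assumes "pathin riemann_sphere g"
  shows "connectedin riemann_sphere (curve_image g)"
  using assms unfolding pathin_def
  by (intro connectedin_continuous_map_image[of "top_of_set {0..1}"])
     (auto simp: connectedin_subtopology)

section \<open>Separation of the sphere by closed curves and by arcs\<close>

lemma sphere_Jordan:
  assumes "simple_closed_curve g" "Some q \<notin> curve_image g"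
  obtains W where "openin riemann_sphere W" "W \<noteq> {}" "Some q \<notin> W"
    "riemann_sphere frontier_of W = curve_image g"
proof -
  let ?c = "lift_curve q g"
  \<comment> \<open>The omitted point \<open>Some q\<close> plays the part of infinity for the
    chart, so the inside of the lifted loop is the region away from it.\<close>
  define inner where "inner = inside (path_image ?c)"
  have J: "inner \<noteq> {}" "open inner" "bounded inner" "frontier inner = path_image ?c"
    using Jordan_inside_outside[OF simple_loop_lift_curve[OF assms]] by (simp_all add: inner_def)
  define W where "W = chart q ` inner"
  have vW: "chart q -` W = inner"
    by (simp add: W_def inj_vimage_image_eq inj_chart)
  have oW: "openin riemann_sphere W" by (simp add: W_def J openin_chart_image)
  \<comment> \<open>The chart cannot see \<open>Some q\<close>, which must be kept out of the
    frontier separately: the closure of a bounded set is compact, so its image is closed in the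
    sphere and misses that point.\<close>
  have "compactin riemann_sphere (chart q ` closure inner)"
    by (rule image_compactin[OF _ continuous_map_chart]) (simp add: J(3))
  then have "closedin riemann_sphere (chart q ` closure inner)"
    by (rule compactin_imp_closedin[OF Hausdorff_riemann_sphere])
  then have "riemann_sphere closure_of W \<subseteq> chart q ` closure inner"
    unfolding W_def by (intro closure_of_minimal[OF image_mono[OF closure_subset]])
  then have "Some q \<notin> riemann_sphere closure_of W" by (metis chart_ne' image_iff subsetD)
  then have "Some q \<notin> riemann_sphere frontier_of W" by (simp add: frontier_of_def)
  moreover have eq: "chart q -` (riemann_sphere frontier_of W) = chart q -` curve_image g"
    unfolding frontier_chart_vimage[symmetric] path_image_lift_curve[OF assms(2), symmetric] vW
    by (rule J(4))
  have "riemann_sphere frontier_of W - {Some q} = curve_image g - {Some q}"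
    using arg_cong[OF eq, of "(`) (chart q)"] by (simp only: chart_image_vimage)
  ultimately have "riemann_sphere frontier_of W = curve_image g"
    using assms(2) by simp
  moreover have "W \<noteq> {}" "Some q \<notin> W" using J(1) by (auto simp: W_def)
  ultimately show thesis using that[OF oW] by blast
qed

text \<open>Janiszewski's theorem in its simplest case: the new arc and the union of the others are
  compact, neither separates the plane, and their intersection is empty, hence connected.\<close>

lemma compl_disjoint_arcs_connected:
  fixes g :: "'a \<Rightarrow> real \<Rightarrow> complex"
  assumes "finite M" "\<And>m. m \<in> M \<Longrightarrow> arc (g m)" "disjoint_family_on (\<lambda>m. path_image (g m)) M"
  shows "connected (- (\<Union>m\<in>M. path_image (g m)))"
  using assms
proof (induction M)
  case (insert m M)
  have disj: "path_image (g m) \<inter> (\<Union>m\<in>M. path_image (g m)) = {}"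
    using insert by (fastforce simp: disjoint_family_on_def)
  have "connected (- (\<Union>m\<in>M. path_image (g m)))"
    using insert by (simp add: disjoint_family_on_def)
  moreover have "connected (- path_image (g m))"
    using insert by (simp add: connected_arc_complement)
  ultimately have "connected (- (path_image (g m) \<union> (\<Union>m\<in>M. path_image (g m))))"
    using disj insert by (intro Janiszewski_connected) 
      (auto intro!: compact_arc_image closed_UN compact_imp_closed)
  then show ?case by simp
qed (simp add: connected_UNIV)

lemma sphere_compl_disjoint_arcs_connected:
  assumes "finite M" "\<And>m. m \<in> M \<Longrightarrow> sphere_arc (g m)"
    "disjoint_family_on (\<lambda>m. curve_image (g m)) M" "\<And>m. m \<in> M \<Longrightarrow> Some q \<notin> curve_image (g m)"
  shows "connectedin riemann_sphere (- (\<Union>m\<in>M. curve_image (g m)))"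
proof -
  let ?K = "\<Union>m\<in>M. curve_image (g m)"
  have eq: "chart q -` ?K = (\<Union>m\<in>M. path_image (lift_curve q (g m)))"
    using assms(4) by (simp add: path_image_lift_curve vimage_Union)
  have "connected (- (\<Union>m\<in>M. path_image (lift_curve q (g m))))"
  proof (intro compl_disjoint_arcs_connected)
    show "disjoint_family_on (\<lambda>m. path_image (lift_curve q (g m))) M"
      using assms(3,4) unfolding disjoint_family_on_def
      by (simp add: path_image_lift_curve flip: vimage_Int)
  qed (use assms arc_lift_curve in auto)
  then have "connectedin euclidean (chart q -` (- ?K))"
    by (simp only: vimage_Compl eq connectedin_iff_connected)
  then have "connectedin riemann_sphere (chart q ` (chart q -` (- ?K)))"
    using connectedin_continuous_map_image continuous_map_chart by blast
  then have con: "connectedin riemann_sphere (- ?K - {Some q})"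
    by (simp only: chart_image_vimage)
  have "closedin riemann_sphere ?K"
    using assms(1,2) by (auto intro!: closedin_Union closedin_curve_image simp: sphere_arc_def)
  then have op: "openin riemann_sphere (- ?K)"
    by (simp add: closedin_def Compl_eq_Diff_UNIV)
  \<comment> \<open>The chart yields connectedness only after puncturing the complement at
    \<open>q\<close>. The complement is open, so \<open>q\<close> is a limit of the punctured set,
    and a set between a connected set and its closure is connected.\<close>
  have "Some q \<in> riemann_sphere closure_of (- ?K - {Some q})"
    unfolding in_closure_of
  proof (intro conjI allI impI)
    fix T assume T: "Some q \<in> T \<and> openin riemann_sphere T"
    then have "open (Some -` (T \<inter> - ?K))"
      using op by (metis openin_Int openin_riemann_sphere)
    moreover have "q \<in> Some -` (T \<inter> - ?K)" using T assms(4) by auto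
    ultimately obtain z where "z \<in> Some -` (T \<inter> - ?K)" "z \<noteq> q"
      by (metis is_singletonI' is_singleton_def not_open_singleton empty_iff)
    then show "\<exists>y. y \<in> - ?K - {Some q} \<and> y \<in> T" by auto
  qed simp
  then have "- ?K \<subseteq> riemann_sphere closure_of (- ?K - {Some q})"
    using closure_of_subset[of "- ?K - {Some q}" riemann_sphere] by auto
  then show ?thesis
    using connectedin_intermediate_closure_of[OF con] by blast
qed

text \<open>A closed curve separates \<open>q\<close> from the Jordan region \<open>W\<close>,
  whereas an arc separates nothing.\<close>

lemma sphere_arc_not_closed_curve:
  assumes "simple_closed_curve c" "sphere_arc g" "Some q \<notin> curve_image c"
  shows "curve_image c \<noteq> curve_image g"
proof
  assume eq: "curve_image c = curve_image g"
  obtain W where W: "openin riemann_sphere W" "W \<noteq> {}" "Some q \<notin> W"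
    "riemann_sphere frontier_of W = curve_image c"
    using sphere_Jordan assms by metis
  have "connectedin riemann_sphere (- (\<Union>m\<in>{()}. curve_image g))"
    using assms eq by (intro sphere_compl_disjoint_arcs_connected[where q = q]) (auto simp: disjoint_family_on_def)
  then have "connectedin riemann_sphere (- curve_image g)" by simp
  moreover have "W \<inter> curve_image g = {}"
    using frontier_of_openin[OF W(1)] W(4) eq by blast
  then have "- curve_image g \<inter> W \<noteq> {}" using W(2) by blast
  moreover have "- curve_image g - W \<noteq> {}" using W(3) assms(3) eq by blast
  ultimately have "- curve_image g \<inter> riemann_sphere frontier_of W \<noteq> {}"
    by (rule connectedin_Int_frontier_of)
  then show False using W(4) eq by auto
qed

text \<open>If an arc is not entirely contained in the closure of \<open>F\<close>, then the part of it on the near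
  side of the gap is a hair, which by Janiszewski's theorem separates nothing.\<close>

lemma arc_hair:
  fixes g :: "real \<Rightarrow> complex"
  assumes g: "arc g" and K: "closed K" "path_image g \<inter> K \<subseteq> {g 0, g 1}"
    and F: "frontier F \<subseteq> K \<union> path_image g" "F \<inter> (K \<union> path_image g) = {}"
    and t: "0 < t" "t < u" "u < 1" and gt: "g t \<in> closure F" and gu: "g u \<notin> closure F"
  obtains N where "open N" "g t \<in> N" "N - path_image g \<subseteq> F"
proof -
  have inj: "inj_on g {0..1}" and cont: "continuous_on {0..1} g"
    using g by (auto simp: arc_def path_def)
  have op: "openin (top_of_set {0..1}) ({0..1} \<inter> g -` (- closure F))"
    using cont by (intro continuous_openin_preimage_gen) auto
  obtain e where e: "e > 0" "\<And>s. s \<in> {0..1} \<Longrightarrow> \<bar>s - u\<bar> < e \<Longrightarrow> g s \<notin> closure F"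
  proof -
    have "u \<in> {0..1} \<inter> g -` (- closure F)" using gu t by auto
    then obtain e where e: "e > 0" "ball u e \<inter> {0..1} \<subseteq> {0..1} \<inter> g -` (- closure F)"
      using op unfolding openin_contains_ball by blast
    have "g s \<notin> closure F" if "s \<in> {0..1}" "\<bar>s - u\<bar> < e" for s
    proof -
      have "s \<in> ball u e \<inter> {0..1}" using that by (simp add: dist_real_def abs_minus_commute)
      with e(2) show ?thesis by blast
    qed
    with e(1) show thesis by (rule that)
  qed
  \<comment> \<open>The parameters from \<open>u1\<close> to \<open>u2\<close> form a gap around
    \<open>u\<close> that stays away from \<open>closure F\<close>, to the right of \<open>t\<close>
    and to the left of \<open>1\<close>.\<close>
  define u1 where "u1 = max ((t + u) / 2) (u - e / 2)"
  define u2 where "u2 = min ((1 + u) / 2) (u + e / 2)"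
  have u: "t < u1" "u1 < u" "u < u2" "u2 < 1"
    using t e(1) by (auto simp: u1_def u2_def field_simps max_def min_def)
  have gap: "g s \<notin> closure F" if "u1 \<le> s" "s \<le> u2" for s
    using that t u e(1) by (intro e(2)) (auto simp: u1_def u2_def)
  \<comment> \<open>\<open>A1\<close> is the hair, which carries \<open>g t\<close>;
    \<open>T\<close> collects \<open>K\<close> and the part of the arc beyond the gap. They can meet
    only in \<open>g 0\<close>, so their intersection is connected as Janiszewski's theorem
    requires.\<close>
  define A1 where "A1 = g ` {0..u1}"
  define T where "T = K \<union> g ` {u2..1}"
  have "compact A1" "compact (g ` {u2..1})"
    unfolding A1_def using cont t u
    by (auto intro!: compact_continuous_image elim: continuous_on_subset)
  then have clT: "closed T" by (simp add: T_def K(1) compact_imp_closed closed_Un)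
  have "A1 \<inter> T \<subseteq> {g 0}"
  proof
    fix x assume "x \<in> A1 \<inter> T"
    then obtain s where s: "s \<in> {0..u1}" "x = g s" "x \<in> K \<or> x \<in> g ` {u2..1}"
      by (auto simp: A1_def T_def)
    have ne: "g s \<noteq> g r" if "r \<in> {u2..1}" for r
      using inj_onD[OF inj, of s r] s(1) that u t by fastforce
    have "x \<notin> g ` {u2..1}" unfolding s(2) using ne by blast
    moreover have "x \<noteq> g 1" unfolding s(2) using u by (intro ne) simp
    moreover have "x \<in> path_image g" using s(1,2) u t by (auto simp: path_image_def)
    ultimately show "x \<in> {g 0}" using s(2,3) K(2) by auto
  qed
  then have "A1 \<inter> T = {} \<or> A1 \<inter> T = {g 0}" by blast
  then have conT: "connected (A1 \<inter> T)" by auto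
  have "g t \<notin> T"
  proof -
    have "g t \<notin> g ` {u2..1}" "g t \<noteq> g 0" "g t \<noteq> g 1"
      using inj_onD[OF inj, of t] t u by fastforce+
    moreover have "g t \<in> path_image g" using t by (auto simp: path_image_def)
    ultimately show ?thesis using K(2) by (auto simp: T_def)
  qed
  then obtain r where r: "r > 0" "ball (g t) r \<subseteq> - T"
    using clT by (meson ComplI open_Compl open_contains_ball)
  obtain x where x: "x \<in> F" "x \<in> ball (g t) r"
    using gt r(1) by (metis closure_approachable mem_ball dist_commute)
  have "y \<in> F" if y: "y \<in> ball (g t) r" "y \<notin> path_image g" for y
  proof (rule ccontr)
    assume "y \<notin> F"
    have "arc (subpath 0 u1 g)"
      using g t u by (intro arc_subpath_arc) auto
    then have "connected (- A1)"
      using connected_arc_complement[of "subpath 0 u1 g"] t u by (simp add: A1_def path_image_subpath)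
    moreover have "A1 \<subseteq> path_image g" using t u by (auto simp: A1_def path_image_def)
    ultimately have "connected_component (- A1) x y"
      using x(1) y(2) F(2) by (auto simp: connected_iff_connected_component)
    moreover have "connected_component (- T) x y"
      unfolding connected_component_def using r(2) x(2) y(1) by (intro exI[of _ "ball (g t) r"]) auto
    \<comment> \<open>The points \<open>x\<close> and \<open>y\<close> are joined off
      \<open>A1\<close>, an arc, and off \<open>T\<close>, inside the ball; hence they are joined
      off both. Such a connection can cross the frontier of \<open>F\<close> only in the gap, where
      there is no point of \<open>closure F\<close>.\<close>
    ultimately have "connected_component (- (A1 \<union> T)) x y"
      using \<open>compact A1\<close> clT conT by (intro Janiszewski) auto
    then obtain C where C: "connected C" "C \<subseteq> - (A1 \<union> T)" "x \<in> C" "y \<in> C"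
      by (auto simp: connected_component_def)
    then have "C \<inter> frontier F \<noteq> {}"
      using x(1) \<open>y \<notin> F\<close> by (intro connected_Int_frontier) auto
    then obtain z where z: "z \<in> C" "z \<in> frontier F" by auto
    then have "z \<in> path_image g" "z \<in> closure F"
      using F(1) C(2) by (auto simp: T_def frontier_def)
    then obtain s where s: "s \<in> {0..1}" "z = g s" by (auto simp: path_image_def)
    then have "u1 < s" "s < u2"
      using z(1) C(2) s by (auto simp: A1_def T_def not_le[symmetric])
    then show False using gap \<open>z \<in> closure F\<close> s by auto
  qed
  then have "ball (g t) r - path_image g \<subseteq> F" by blast
  then show thesis using that[of "ball (g t) r"] r(1) by simp
qed

text \<open>A gap on either side of \<open>t\<close> would make \<open>F\<close> fill a
  neighbourhood of \<open>g t\<close> up to the arc, against \<open>no\<close>. Gaps after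
  \<open>t\<close> are the case of \<open>arc_hair\<close>, gaps before \<open>t\<close> that of the
  reversed arc; the two ends of the arc follow by continuity.\<close>

lemma arc_frontier_dichotomy:
  fixes g :: "real \<Rightarrow> complex"
  assumes g: "arc g" and K: "closed K" "path_image g \<inter> K \<subseteq> {g 0, g 1}"
    and F: "frontier F \<subseteq> K \<union> path_image g" "F \<inter> (K \<union> path_image g) = {}"
    and t: "0 < t" "t < 1" and gt: "g t \<in> closure F"
    and no: "\<And>N. open N \<Longrightarrow> g t \<in> N \<Longrightarrow> \<not> N - path_image g \<subseteq> F"
  shows "path_image g \<subseteq> closure F"
proof (rule ccontr)
  have cont: "continuous_on {0..1} g" using g by (auto simp: arc_def path_def)
  have in01: "g u \<in> closure F" if u: "0 < u" "u < 1" for u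
  proof (rule ccontr)
    assume gu: "g u \<notin> closure F"
    then have "u \<noteq> t" using gt by auto
    then consider "t < u" | "u < t" by linarith
    then show False
    proof cases
      case 1
      then show False using arc_hair[OF g K F t(1) _ u(2) gt gu] no by metis
    next
      case 2
      have "path_image (reversepath g) \<inter> K \<subseteq> {reversepath g 0, reversepath g 1}"
        unfolding path_image_reversepath using K(2) by (auto simp: reversepath_def)
      moreover have "reversepath g (1 - t) \<in> closure F" "reversepath g (1 - u) \<notin> closure F"
        using gt gu by (simp_all add: reversepath_def)
      moreover have "frontier F \<subseteq> K \<union> path_image (reversepath g)"
        "F \<inter> (K \<union> path_image (reversepath g)) = {}"
        using F by simp_all
      moreover have "arc (reversepath g)" "0 < 1 - t" "1 - t < 1 - u" "1 - u < 1"
        using g t u 2 by (simp_all add: arc_reversepath)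
      ultimately obtain N where N: "open N" "reversepath g (1 - t) \<in> N" "N - path_image (reversepath g) \<subseteq> F"
        using arc_hair[of "reversepath g" K F "1 - t" "1 - u"] K(1) by blast
      then have "g t \<in> N" by (simp add: reversepath_def)
      then show False using no N by simp
    qed
  qed
  have "g ` {0..1} \<subseteq> closure F"
  proof -
    have "{0..1} = closure {0<..<1::real}" by simp
    moreover have "g ` closure {0<..<1} \<subseteq> closure F"
      using in01 cont by (intro image_closure_subset) auto
    ultimately show ?thesis by simp
  qed
  moreover assume "\<not> path_image g \<subseteq> closure F"
  ultimately show False by (simp add: path_image_def)
qed

text \<open>The chart at \<open>q\<close> carries the planar dichotomy over. It is meant for a face
  \<open>F\<close> touching an edge \<open>g\<close>, with \<open>K\<close> the union of all other
  edges.\<close>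

lemma sphere_arc_frontier_dichotomy:
  assumes g: "sphere_arc g" and K: "closedin riemann_sphere K" "curve_image g \<inter> K \<subseteq> {g 0, g 1}"
    and F: "riemann_sphere frontier_of F \<subseteq> K \<union> curve_image g" "F \<inter> (K \<union> curve_image g) = {}"
    and t: "0 < t" "t < 1" and gt: "g t \<in> riemann_sphere closure_of F"
    and no: "\<And>N. openin riemann_sphere N \<Longrightarrow> g t \<in> N \<Longrightarrow> \<not> N - curve_image g \<subseteq> F"
    and q: "Some q \<notin> curve_image g"
  shows "curve_image g \<subseteq> riemann_sphere closure_of F"
proof -
  let ?v = "\<lambda>S. chart q -` S" and ?g = "lift_curve q g"
  have pi: "path_image ?g = ?v (curve_image g)" by (rule path_image_lift_curve[OF q])
  have gs: "chart q (?g s) = g s" if "s \<in> {0..1}" for s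
    using q that by (intro chart_lift_curve) (metis imageI)
  have "path_image ?g \<subseteq> closure (?v F)"
  proof (rule arc_frontier_dichotomy)
    show "arc ?g" using g q by (rule arc_lift_curve)
    show "closed (?v K)" using K(1) by (rule closed_chart_vimage)
    show "path_image ?g \<inter> ?v K \<subseteq> {?g 0, ?g 1}"
    proof
      fix w assume "w \<in> path_image ?g \<inter> ?v K"
      then have "chart q w \<in> {g 0, g 1}" using K(2) pi by auto
      then have "chart q w = chart q (?g 0) \<or> chart q w = chart q (?g 1)" by (simp add: gs)
      then show "w \<in> {?g 0, ?g 1}" by (auto dest: injD[OF inj_chart])
    qed
    show "frontier (?v F) \<subseteq> ?v K \<union> path_image ?g"
      using F(1) by (auto simp: frontier_chart_vimage pi)
    show "?v F \<inter> (?v K \<union> path_image ?g) = {}"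
      using F(2) by (auto simp: pi)
    show "?g t \<in> closure (?v F)"
      using gt t by (simp add: closure_chart_vimage gs)
    show "\<not> N - path_image ?g \<subseteq> ?v F" if "open N" "?g t \<in> N" for N
    proof
      assume *: "N - path_image ?g \<subseteq> ?v F"
      have "openin riemann_sphere (chart q ` N)" using that by (simp add: openin_chart_image)
      moreover have "g t \<in> chart q ` N" using gs[of t] t that by force
      ultimately have "\<not> chart q ` N - curve_image g \<subseteq> F" by (rule no)
      then show False using * pi by auto
    qed
  qed (use t in auto)
  then show ?thesis
    using gs by (auto simp: closure_chart_vimage path_image_def)
qed

lemma connectedin_Some_image: "connected S \<Longrightarrow> connectedin riemann_sphere (Some ` S)"
  using connectedin_continuous_map_image[OF continuous_map_Some] by simp

lemma connectedin_chart_image: "connected S \<Longrightarrow> connectedin riemann_sphere (chart q ` S)"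
  using connectedin_continuous_map_image[OF continuous_map_chart] by simp

section \<open>Half-planes and reflection\<close>

lemma openin_Compl_iff_closedin: "openin riemann_sphere (- S) \<longleftrightarrow> closedin riemann_sphere S"
  by (simp add: closedin_def Compl_eq_Diff_UNIV)

lemma in_closure_of_riemann_sphere:
  "x \<in> riemann_sphere closure_of S \<longleftrightarrow> (\<forall>T. openin riemann_sphere T \<and> x \<in> T \<longrightarrow> S \<inter> T \<noteq> {})"
  by (auto simp: in_closure_of)

definition lower_half_plane :: "complex option set" where
  "lower_half_plane = Some ` {z. Im z < 0}"

lemma reflect_simps [simp]:
  "reflect None = None" "reflect (Some z) = Some (cnj z)" "reflect (reflect p) = p"
  by (cases p; simp add: reflect_def)+

lemma reflect_image_image [simp]: "reflect ` reflect ` S = S"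
  by (simp add: image_image)

lemma reflect_eq_iff [simp]: "reflect p = reflect p' \<longleftrightarrow> p = p'"
  by (metis reflect_simps(3))

lemma reflect_image_iff: "reflect p \<in> S \<longleftrightarrow> p \<in> reflect ` S"
  by (metis image_iff reflect_simps(3))

lemma extended_reals_iff: "Some z \<in> extended_reals \<longleftrightarrow> Im z = 0" "None \<in> extended_reals"
  by (auto simp: extended_reals_def complex_is_Real_iff)

lemma extended_reals_cases:
  assumes "x \<in> extended_reals"
  obtains "x = None" | r where "x = Some (complex_of_real r)"
  using assms by (auto simp: extended_reals_def elim: Reals_cases)

lemma upper_half_plane_iff [simp]:
  "Some z \<in> upper_half_plane \<longleftrightarrow> 0 < Im z" "None \<notin> upper_half_plane"
  by (auto simp: upper_half_plane_def)

lemma lower_half_plane_iff [simp]: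
  "Some z \<in> lower_half_plane \<longleftrightarrow> Im z < 0" "None \<notin> lower_half_plane"
  by (auto simp: lower_half_plane_def)

lemma half_planes_disjoint:
  "upper_half_plane \<inter> lower_half_plane = {}" "upper_half_plane \<inter> extended_reals = {}"
  "lower_half_plane \<inter> extended_reals = {}"
  by (auto simp: upper_half_plane_def lower_half_plane_def extended_reals_iff)

lemma half_plane_cases:
  "x \<in> upper_half_plane \<or> x \<in> lower_half_plane \<or> x \<in> extended_reals"
  by (cases x) (auto simp: extended_reals_iff)

lemma reflect_extended_reals: "x \<in> extended_reals \<Longrightarrow> reflect x = x"
  by (elim extended_reals_cases) auto

lemma reflect_half_plane [simp]:
  "reflect x \<in> upper_half_plane \<longleftrightarrow> x \<in> lower_half_plane"
  "reflect x \<in> lower_half_plane \<longleftrightarrow> x \<in> upper_half_plane"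
  "reflect x \<in> extended_reals \<longleftrightarrow> x \<in> extended_reals"
  by (cases x; simp add: extended_reals_iff)+

lemma openin_half_planes:
  "openin riemann_sphere upper_half_plane" "openin riemann_sphere lower_half_plane"
  unfolding upper_half_plane_def lower_half_plane_def
  by (intro openin_Some_image open_halfspace_Im_gt open_halfspace_Im_lt)+

lemma closedin_extended_reals: "closedin riemann_sphere extended_reals"
proof -
  have "- extended_reals = upper_half_plane \<union> lower_half_plane"
    using half_planes_disjoint half_plane_cases by blast
  then have "openin riemann_sphere (- extended_reals)"
    by (simp add: openin_half_planes openin_Un)
  then show ?thesis by (simp add: openin_Compl_iff_closedin)
qed

lemma homeomorphic_map_reflect: "homeomorphic_map riemann_sphere riemann_sphere reflect"
proof -
  have "openin riemann_sphere (reflect -` V)" if "openin riemann_sphere V" for V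
  proof -
    have eq: "Some -` reflect -` V = cnj -` (Some -` V)" by auto
    have "open (cnj -` (Some -` V))"
      using that by (intro open_vimage continuous_intros) (simp add: openin_riemann_sphere)
    moreover have "bounded (- (cnj -` (Some -` V)))" if "bounded (- (Some -` V))"
      using that unfolding bounded_iff by (metis ComplD ComplI complex_mod_cnj vimage_eq)
    ultimately show ?thesis
      using that unfolding openin_riemann_sphere eq by simp
  qed
  then have "continuous_map riemann_sphere riemann_sphere reflect"
    by (auto simp: continuous_map_def vimage_def)
  then show ?thesis
    unfolding homeomorphic_map_maps homeomorphic_maps_def by (intro exI[of _ reflect]) auto
qed

lemma closure_of_reflect: "riemann_sphere closure_of (reflect ` S) = reflect ` (riemann_sphere closure_of S)"
  by (simp add: homeomorphic_map_closure_of[OF homeomorphic_map_reflect])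

lemma frontier_of_reflect: "riemann_sphere frontier_of (reflect ` S) = reflect ` (riemann_sphere frontier_of S)"
  by (simp add: homeomorphic_map_frontier_of[OF homeomorphic_map_reflect])

lemma connectedin_reflect: "connectedin riemann_sphere (reflect ` S) \<longleftrightarrow> connectedin riemann_sphere S"
  by (simp add: homeomorphic_map_connectedness[OF homeomorphic_map_reflect])

lemma openin_reflect: "openin riemann_sphere (reflect ` S) \<longleftrightarrow> openin riemann_sphere S"
  by (simp add: homeomorphic_map_openness[OF homeomorphic_map_reflect])

lemma closedin_reflect: "closedin riemann_sphere (reflect ` S) \<longleftrightarrow> closedin riemann_sphere S"
  by (simp add: homeomorphic_map_closedness[OF homeomorphic_map_reflect])

section \<open>Disc neighbourhoods and local connectedness\<close>

lemma chart_0: "chart 0 w = (if w = 0 then None else Some (1 / w))"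
  by (simp add: chart_def sphere_inversion_def)

text \<open>Discs and half discs are convex, hence connected; at infinity they are taken in the
  coordinate \<open>1 / w\<close>. The same neighbourhoods give local connectedness of the sphere
  and the local picture of faces along the real line.\<close>

lemma sphere_disc_neighbourhood:
  assumes "openin riemann_sphere T" "x \<in> T"
  obtains N where "openin riemann_sphere N" "x \<in> N" "N \<subseteq> T" "connectedin riemann_sphere N"
    "connectedin riemann_sphere (N \<inter> upper_half_plane)"
    "connectedin riemann_sphere (N \<inter> lower_half_plane)"
    "x \<in> extended_reals \<Longrightarrow> N \<inter> upper_half_plane \<noteq> {}"
    "x \<in> extended_reals \<Longrightarrow> N \<inter> lower_half_plane \<noteq> {}"
proof (cases x)
  case None
  have "open (chart 0 -` T)" "0 \<in> chart 0 -` T"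
    using assms None by (auto simp: open_chart_vimage chart_0)
  then obtain r where r: "r > 0" "ball 0 r \<subseteq> chart 0 -` T"
    using open_contains_ball by blast
  define N where "N = chart 0 ` ball 0 r"
  have im: "Im (1 / w) = - Im w / (norm w)\<^sup>2" for w :: complex
    by (simp add: Im_divide cmod_power2)
  \<comment> \<open>The map \<open>1 / w\<close> exchanges the two half-planes, so the signs are
    swapped.\<close>
  have up: "N \<inter> upper_half_plane = chart 0 ` (ball 0 r \<inter> {w. Im w < 0})"
    and lo: "N \<inter> lower_half_plane = chart 0 ` (ball 0 r \<inter> {w. 0 < Im w})"
    unfolding N_def by (auto simp: chart_0 im divide_less_0_iff zero_less_divide_iff split: if_splits)
  have ball: "- (\<i> * complex_of_real (r / 2)) \<in> ball 0 r \<inter> {w. Im w < 0}"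
    "\<i> * complex_of_real (r / 2) \<in> ball 0 r \<inter> {w. 0 < Im w}"
    using r(1) by (auto simp: norm_mult)
  show thesis
  proof (rule that[of N])
    show "connectedin riemann_sphere (N \<inter> upper_half_plane)"
      "connectedin riemann_sphere (N \<inter> lower_half_plane)" "connectedin riemann_sphere N"
      unfolding up lo unfolding N_def
      by (intro connectedin_chart_image convex_connected convex_Int convex_ball
          convex_halfspace_Im_lt convex_halfspace_Im_gt)+
    show "openin riemann_sphere N" by (simp add: N_def openin_chart_image)
    show "x \<in> N" using r(1) by (auto simp: None N_def chart_0 image_iff intro!: bexI[of _ 0])
    show "N \<subseteq> T" using r(2) by (auto simp: N_def)
    show "N \<inter> upper_half_plane \<noteq> {}" "N \<inter> lower_half_plane \<noteq> {}"
      unfolding up lo using ball by blast+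
  qed
next
  case (Some z)
  have "open (Some -` T)" "z \<in> Some -` T"
    using assms Some by (auto simp: openin_riemann_sphere)
  then obtain r where r: "r > 0" "ball z r \<subseteq> Some -` T"
    using open_contains_ball by blast
  define N where "N = Some ` ball z r"
  have up: "N \<inter> upper_half_plane = Some ` (ball z r \<inter> {w. 0 < Im w})"
    and lo: "N \<inter> lower_half_plane = Some ` (ball z r \<inter> {w. Im w < 0})"
    unfolding N_def by auto
  have ball: "z + \<i> * complex_of_real (r / 2) \<in> ball z r" "z - \<i> * complex_of_real (r / 2) \<in> ball z r"
    using r(1) by (auto simp: dist_norm norm_mult)
  show thesis
  proof (rule that[of N])
    show "connectedin riemann_sphere (N \<inter> upper_half_plane)"
      "connectedin riemann_sphere (N \<inter> lower_half_plane)" "connectedin riemann_sphere N"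
      unfolding up lo unfolding N_def
      by (intro connectedin_Some_image convex_connected convex_Int convex_ball
          convex_halfspace_Im_lt convex_halfspace_Im_gt)+
    show "openin riemann_sphere N" by (simp add: N_def openin_Some_image)
    show "x \<in> N" using r(1) by (auto simp: Some N_def)
    show "N \<subseteq> T" using r(2) by (auto simp: N_def)
    assume "x \<in> extended_reals"
    then have "Im z = 0" by (simp add: Some extended_reals_iff)
    then have "z + \<i> * complex_of_real (r / 2) \<in> ball z r \<inter> {w. 0 < Im w}"
      "z - \<i> * complex_of_real (r / 2) \<in> ball z r \<inter> {w. Im w < 0}"
      using r(1) ball by auto
    then show "N \<inter> upper_half_plane \<noteq> {}" "N \<inter> lower_half_plane \<noteq> {}"
      unfolding up lo by blast+
  qed
qed

lemma extended_reals_neighbourhood: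
  assumes "openin riemann_sphere T" "x \<in> T" "x \<in> extended_reals"
  shows "T \<inter> upper_half_plane \<noteq> {}" "T \<inter> lower_half_plane \<noteq> {}"
  using sphere_disc_neighbourhood[OF assms(1,2)] assms(3) by (metis Int_mono order_refl subset_empty)+

lemma locally_connected_riemann_sphere: "locally_connected_space riemann_sphere"
  unfolding locally_connected_space by (metis sphere_disc_neighbourhood)

section \<open>Components of the complement of a closed set\<close>

lemma complement_components_facts:
  assumes "closedin riemann_sphere K" "C \<in> complement_components K"
  shows openin_complement_component: "openin riemann_sphere C"
    and connectedin_complement_component: "connectedin riemann_sphere C"
    and complement_component_nonempty: "C \<noteq> {}"
    and complement_component_disjoint: "C \<inter> K = {}"
proof -
  have "openin riemann_sphere (topspace riemann_sphere - K)"
    using assms(1) by (simp add: closedin_def)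
  then have "locally_connected_space (subtopology riemann_sphere (topspace riemann_sphere - K))"
    using locally_connected_riemann_sphere by (simp add: locally_connected_space_open_subset)
  then have "openin (subtopology riemann_sphere (topspace riemann_sphere - K)) C"
    using openin_connected_components_of_locally_connected_space assms(2) by blast
  then show "openin riemann_sphere C"
    using \<open>openin riemann_sphere (topspace riemann_sphere - K)\<close> openin_trans_full by blast
  show "connectedin riemann_sphere C"
    using connectedin_connected_components_of[OF assms(2)] by (simp add: connectedin_subtopology)
  show "C \<noteq> {}" using nonempty_connected_components_of[OF assms(2)] .
  show "C \<inter> K = {}" using connected_components_of_subset[OF assms(2)] by auto
qed

lemma complement_component_maximal:
  assumes "C \<in> complement_components K" "connectedin riemann_sphere S" "S \<inter> K = {}" "S \<inter> C \<noteq> {}"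
  shows "S \<subseteq> C"
proof -
  have "connectedin (subtopology riemann_sphere (topspace riemann_sphere - K)) S"
    using assms(2,3) by (auto simp: connectedin_subtopology)
  then show ?thesis
    using connected_components_of_maximal[OF assms(1)] assms(4) by (simp add: disjnt_def Int_commute)
qed

lemma complement_component_superset:
  assumes "connectedin riemann_sphere S" "S \<inter> K = {}" "S \<noteq> {}"
  obtains C where "C \<in> complement_components K" "S \<subseteq> C"
proof -
  have con: "connectedin (subtopology riemann_sphere (topspace riemann_sphere - K)) S"
    using assms(1,2) by (auto simp: connectedin_subtopology)
  have "topspace (subtopology riemann_sphere (topspace riemann_sphere - K)) \<noteq> {}"
    using assms(2,3) by auto
  then have "subtopology riemann_sphere (topspace riemann_sphere - K) \<noteq> trivial_topology"
    by (metis null_topspace_iff_trivial)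
  then obtain C where "C \<in> complement_components K" "S \<subseteq> C"
    using exists_connected_component_of_superset[OF con] by blast
  then show thesis by (rule that)
qed

lemma complement_component_eq:
  assumes "C \<in> complement_components K" "C' \<in> complement_components K" "C \<inter> C' \<noteq> {}"
  shows "C = C'"
  using assms connected_components_of_overlap[of C _ C'] by blast

text \<open>Components are open, so a frontier point off \<open>K\<close> would lie in another
  component that nevertheless meets \<open>C\<close>.\<close>

lemma frontier_complement_component:
  assumes "closedin riemann_sphere K" "C \<in> complement_components K"
  shows "riemann_sphere frontier_of C \<subseteq> K"
proof
  fix x assume x: "x \<in> riemann_sphere frontier_of C"
  show "x \<in> K"
  proof (rule ccontr)
    assume "x \<notin> K"
    then obtain C' where C': "C' \<in> complement_components K" "{x} \<subseteq> C'"
      using complement_component_superset[of "{x}" K] by auto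
    have "x \<in> riemann_sphere closure_of C" "x \<notin> C"
      using x frontier_of_openin[OF openin_complement_component[OF assms]] by auto
    then have "C \<inter> C' \<noteq> {}"
      using C' openin_complement_component[OF assms(1) C'(1)]
      unfolding in_closure_of_riemann_sphere by blast
    then show False using complement_component_eq[OF assms(2) C'(1)] C'(2) \<open>x \<notin> C\<close> by blast
  qed
qed

lemma reflect_complement_component:
  assumes "closedin riemann_sphere K" "reflect ` K = K" "C \<in> complement_components K"
  shows "reflect ` C \<in> complement_components K"
proof -
  note C = complement_components_facts[OF assms(1,3)]
  have disj: "reflect ` C \<inter> K = {}" 
    using C(4) assms(2) by (metis image_Int image_empty inj_def reflect_eq_iff)
  have ne: "reflect ` C \<noteq> {}" using C(3) by simp
  have con: "connectedin riemann_sphere (reflect ` C)" using C(2) by (simp add: connectedin_reflect)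
  obtain D where D: "D \<in> complement_components K" "reflect ` C \<subseteq> D"
    using complement_component_superset[OF con disj ne] by blast
  note D' = complement_components_facts[OF assms(1) D(1)]
  have "C \<subseteq> reflect ` D" using image_mono[OF D(2), of reflect] by simp
  moreover have "reflect ` D \<inter> K = {}"
    using D'(4) assms(2) by (metis image_Int image_empty inj_def reflect_eq_iff)
  ultimately have "reflect ` D \<subseteq> C"
    using D'(2) C(3) by (intro complement_component_maximal[OF assms(3)]) (auto simp: connectedin_reflect)
  then have "D \<subseteq> reflect ` C" using image_mono[of "reflect ` D" C reflect] by simp
  with D show ?thesis by auto
qed

section \<open>Segments of the extended real line\<close>

text \<open>The gap around infinity is the one gap whose ends need no search for neighbours: they
  are the maximum and the minimum of the finite set. Every other gap is brought to this one by an
  inversion.\<close>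

lemma real_segment_through_infinity:
  assumes "finite X" "a \<in> X" "b \<in> X" "a \<noteq> b"
  shows "\<exists>e\<in>real_segments ((\<lambda>x. Some (complex_of_real x)) ` X). None \<in> e"
proof -
  define l u where "l = Min X" and "u = Max X"
  have X: "l \<in> X" "u \<in> X" "\<And>x. x \<in> X \<Longrightarrow> l \<le> x \<and> x \<le> u"
    unfolding l_def u_def using assms(1,2) by (auto intro!: Min_in Max_in)
  then have "l < u" using assms(2-4) by (metis antisym_conv2 not_less order_trans)
  define c h where "c = (l + u) / 2" and "h = (u - l) / 2"
  have h: "0 < h" "u = c + h" "l = c - h" using \<open>l < u\<close> by (auto simp: c_def h_def field_simps)
  \<comment> \<open>In the chart at the midpoint \<open>c\<close> the segment is the straight
    interval from \<open>c + 1 / h\<close> to \<open>c - 1 / h\<close>; it passes at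
    \<open>t = 1 / 2\<close> through the coordinate \<open>c\<close>, which is infinity.\<close>
  define g where "g t = chart (complex_of_real c) (complex_of_real (c + (1 - 2 * t) / h))" for t :: real
  have g: "g t = (if t = 1 / 2 then None else Some (complex_of_real (c + h / (1 - 2 * t))))" for t
  proof (cases "t = 1 / 2")
    case True
    then have "1 - 2 * t = 0" by simp
    then have "g t = None" by (simp only: g_def chart_def) simp
    then show ?thesis by (simp only: True if_True refl)
  next
    case False
    then have ne: "complex_of_real (c + (1 - 2 * t) / h) \<noteq> complex_of_real c"
      using h(1) by (simp only: of_real_eq_iff) simp
    have "g t = Some (complex_of_real (c + 1 / ((c + (1 - 2 * t) / h) - c)))"
      unfolding g_def chart_def sphere_inversion_Some[OF ne] by simp
    then show ?thesis using False by simp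
  qed
  have "continuous_map (top_of_set {0..1}) euclidean (\<lambda>t. complex_of_real (c + (1 - 2 * t) / h))"
    using h(1) by (auto intro!: continuous_intros)
  from continuous_map_compose[OF this continuous_map_chart] have "pathin riemann_sphere g"
    by (simp add: pathin_def g_def[abs_def] o_def)
  moreover have "inj_on g {0..1}"
    using h(1) by (auto simp: inj_on_def g_def dest!: injD[OF inj_chart])
  ultimately have "sphere_arc g" by (simp add: sphere_arc_def)
  moreover have "curve_image g \<subseteq> extended_reals" by (auto simp: g extended_reals_iff)
  moreover have "g 0 = Some (complex_of_real u)" "g 1 = Some (complex_of_real l)"
    by (simp_all add: g h)
  moreover have "g ` {0<..<1} \<inter> (\<lambda>x. Some (complex_of_real x)) ` X = {}"
  proof -
    \<comment> \<open>The value lies above \<open>u = c + h\<close> for \<open>t < 1 / 2\<close> and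
      below \<open>l = c - h\<close> for \<open>t > 1 / 2\<close>, hence beyond all points of
      \<open>X\<close>.\<close>
    have ne: "c + h / (1 - 2 * t) \<notin> X" if "0 < t" "t < 1" "t \<noteq> 1 / 2" for t
    proof (cases "t < 1 / 2")
      case True
      then have "h < h / (1 - 2 * t)" using that h(1) by (simp add: field_simps)
      then show ?thesis using X(3) h by fastforce
    next
      case False
      then have "1 - 2 * t < 0" using that by simp
      moreover have "h * (2 * t - 1) < h * 1"
        using that h(1) by (intro mult_strict_left_mono) auto
      ultimately have "h / (1 - 2 * t) < - h"
        by (simp add: neg_divide_less_eq algebra_simps)
      then show ?thesis using X(3) h by fastforce
    qed
    have "g t \<notin> (\<lambda>x. Some (complex_of_real x)) ` X" if "t \<in> {0<..<1}" for t
    proof (cases "t = 1 / 2")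
      case False
      then have "c + h / (1 - 2 * t) \<notin> X" using that by (intro ne) auto
      then show ?thesis
        by (simp only: g False if_False image_iff option.inject of_real_eq_iff) blast
    qed (simp add: g image_iff)
    then show ?thesis by blast
  qed
  ultimately have "curve_image g \<in> real_segments ((\<lambda>x. Some (complex_of_real x)) ` X)"
    using X unfolding real_segments_def by auto
  moreover have "None \<in> curve_image g"
    by (rule image_eqI[of _ _ "1 / 2"]) (simp_all add: g)
  ultimately show ?thesis by blast
qed

lemma real_segments_inversion:
  fixes r :: real
  assumes "e \<in> real_segments W"
  shows "sphere_inversion (complex_of_real r) ` e \<in> real_segments (sphere_inversion (complex_of_real r) ` W)"
proof -
  let ?i = "sphere_inversion (complex_of_real r)"
  obtain g where g: "sphere_arc g" "curve_image g \<subseteq> extended_reals" "g 0 \<in> W" "g 1 \<in> W"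
    "g ` {0<..<1} \<inter> W = {}" "e = curve_image g"
    using assms by (auto simp: real_segments_def)
  have "?i x \<in> extended_reals" if "x \<in> extended_reals" for x
    using that
    by (elim extended_reals_cases) (auto simp: sphere_inversion_def extended_reals_iff Im_divide)
  then have "curve_image (?i \<circ> g) \<subseteq> extended_reals" using g(2) by auto
  moreover have "sphere_arc (?i \<circ> g)"
    using g(1) continuous_map_compose[OF _ continuous_map_sphere_inversion]
    by (auto simp: sphere_arc_def pathin_def inj_on_def)
  moreover have "(?i \<circ> g) ` {0<..<1} \<inter> ?i ` W = {}" using g(5) by auto
  ultimately show ?thesis
    unfolding real_segments_def using g(3,4,6) by (intro CollectI exI[of _ "?i \<circ> g"]) (auto simp: image_comp)
qed

text \<open>Inversion about the given real point preserves the extended real line and moves that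
  point to infinity; the segment found there is carried back by the same involution.\<close>

lemma real_segment_through:
  assumes "finite V" "2 \<le> card V" "V \<subseteq> extended_reals" "x \<in> extended_reals - V"
  shows "\<exists>e\<in>real_segments V. x \<in> e"
proof -
  have inf: "\<exists>e\<in>real_segments W. None \<in> e"
    if W: "finite W" "2 \<le> card W" "W \<subseteq> extended_reals" "None \<notin> W" for W
  proof -
    define X where "X = {r. Some (complex_of_real r) \<in> W}"
    have WX: "W = (\<lambda>x. Some (complex_of_real x)) ` X"
    proof (intro equalityI subsetI)
      fix x assume "x \<in> W"
      with W(3) have "x \<in> extended_reals" by blast
      then show "x \<in> (\<lambda>x. Some (complex_of_real x)) ` X"
        using \<open>x \<in> W\<close> W(4) by (cases rule: extended_reals_cases) (auto simp: X_def)
    qed (auto simp: X_def)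
    have inj: "inj_on (\<lambda>x. Some (complex_of_real x)) X" by (auto simp: inj_on_def)
    have "finite X" "2 \<le> card X"
      using W(1,2) inj by (auto simp: WX card_image finite_image_iff)
    moreover then obtain a b where "a \<in> X" "b \<in> X" "a \<noteq> b"
      by (metis card_le_Suc0_iff_eq not_less_eq_eq numeral_2_eq_2)
    ultimately show ?thesis using real_segment_through_infinity WX by metis
  qed
  have x: "x \<in> extended_reals" "x \<notin> V" using assms(4) by auto
  from x(1) show ?thesis
  proof (cases rule: extended_reals_cases)
    case 1
    with inf assms x show ?thesis by blast
  next
    case (2 r)
    let ?i = "sphere_inversion (complex_of_real r)"
    have "?i y \<in> extended_reals" if "y \<in> extended_reals" for y
      using that
      by (elim extended_reals_cases) (auto simp: sphere_inversion_def extended_reals_iff Im_divide)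
    then have "?i ` V \<subseteq> extended_reals" using assms(3) by auto
    moreover have "None \<notin> ?i ` V" using x(2) 2 by (metis imageE sphere_inversion_eq_None)
    moreover have "card (?i ` V) = card V" by (intro card_image) (auto simp: inj_on_def)
    ultimately obtain e where e: "e \<in> real_segments (?i ` V)" "None \<in> e"
      using inf[of "?i ` V"] assms(1,2) by auto
    have "?i ` ?i ` V = V" by (simp add: image_image)
    then have "?i ` e \<in> real_segments V" using real_segments_inversion[OF e(1), of r] by simp
    moreover have "x \<in> ?i ` e" using e(2) 2 by (metis imageI sphere_inversion_simps(1))
    ultimately show ?thesis by blast
  qed
qed

section \<open>Faces of a generic real graph\<close>

text \<open>Fixes a matching and arcs, whose existence is all that the graph definition asserts. The
  bound \<open>2 \<le> card V\<close> comes from \<open>2 \<le> d\<close> and gives every gap on the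
  real line two distinct ends.\<close>

locale real_graph =
  fixes V :: "complex option set" and M :: "complex option set set"
    and \<alpha> :: "complex option set \<Rightarrow> complex option set" and E :: "complex option set set"
  assumes V: "V \<subseteq> extended_reals" "finite V" "2 \<le> card V"
    and matching: "perfect_matching V M"
    and arcs: "\<And>m. m \<in> M \<Longrightarrow> upper_arc m (\<alpha> m)"
    and disjoint: "disjoint_family_on \<alpha> M"
    and E_def: "E = real_segments V \<union> \<alpha> ` M \<union> (\<lambda>m. reflect ` \<alpha> m) ` M"
begin

definition upper_arcs where "upper_arcs = (\<Union>m\<in>M. \<alpha> m)"

abbreviation "cl S \<equiv> riemann_sphere closure_of S"

lemma finite_M: "finite M"
  using matching V(2) finite_elements unfolding perfect_matching_def by blast

lemma Union_M: "\<Union>M = V"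
  using matching by (simp add: perfect_matching_def partition_on_def)

lemma upper_arcE:
  assumes "m \<in> M"
  obtains g where "sphere_arc g" "{g 0, g 1} = m" "g ` {0<..<1} \<subseteq> upper_half_plane" "\<alpha> m = curve_image g"
  using arcs[OF assms] unfolding upper_arc_def by blast

lemma unit_interval_split: "{0..1::real} = insert 0 (insert 1 {0<..<1})"
  by auto

lemma arc_subset: "m \<in> M \<Longrightarrow> \<alpha> m \<subseteq> m \<union> upper_half_plane"
  by (erule upper_arcE) (auto simp: unit_interval_split)

lemma arc_ends:
  assumes "m \<in> M"
  shows "m \<subseteq> \<alpha> m \<and> m \<subseteq> V"
proof
  show "m \<subseteq> \<alpha> m" using assms by (rule upper_arcE) auto
  show "m \<subseteq> V" using assms Union_M by blast
qed

lemma closedin_arc: "m \<in> M \<Longrightarrow> closedin riemann_sphere (\<alpha> m)"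
  by (erule upper_arcE) (simp add: sphere_arc_def closedin_curve_image)

lemma closedin_upper_arcs: "closedin riemann_sphere upper_arcs"
  unfolding upper_arcs_def using finite_M closedin_arc by (intro closedin_Union) auto

lemma upper_arcs_subset: "upper_arcs \<subseteq> V \<union> upper_half_plane"
  unfolding upper_arcs_def using arc_subset arc_ends by blast

lemma V_subset_arcs: "V \<subseteq> upper_arcs"
  unfolding upper_arcs_def using Union_M arc_ends by blast

lemma reflect_V: "x \<in> V \<Longrightarrow> reflect x = x"
  using V(1) reflect_extended_reals by blast

lemma lower_arcs_subset: "reflect ` upper_arcs \<subseteq> V \<union> lower_half_plane"
proof
  fix x assume "x \<in> reflect ` upper_arcs"
  then have "reflect x \<in> V \<union> upper_half_plane" using upper_arcs_subset by auto
  then show "x \<in> V \<union> lower_half_plane"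
  proof
    assume *: "reflect x \<in> V"
    then have "reflect x = x" using reflect_V[of "reflect x"] by (metis reflect_simps(3))
    then show ?thesis using * by simp
  qed simp
qed

lemma real_segment_subset: "e \<in> real_segments V \<Longrightarrow> e \<subseteq> extended_reals"
  by (auto simp: real_segments_def)

text \<open>Vertices are ends of upper arcs, and the other real points lie on segments. In this form
  closedness needs only finitely many arcs and no count of segments, and the reflection symmetry is
  evident.\<close>

lemma Union_E: "\<Union>E = extended_reals \<union> upper_arcs \<union> reflect ` upper_arcs"
proof -
  have a: "extended_reals \<subseteq> \<Union>(real_segments V) \<union> V"
    using real_segment_through[OF V(2,3,1)] by blast
  have b: "\<Union>(real_segments V) \<subseteq> extended_reals" using real_segment_subset by blast
  have "\<Union>E = \<Union>(real_segments V) \<union> upper_arcs \<union> reflect ` upper_arcs"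
    by (simp add: E_def upper_arcs_def image_UN Union_Un_distrib)
  also have "\<dots> = extended_reals \<union> upper_arcs \<union> reflect ` upper_arcs"
    using a b V_subset_arcs by (intro equalityI subsetI) (elim UnE; blast)+
  finally show ?thesis .
qed

lemma closedin_Union_E: "closedin riemann_sphere (\<Union>E)"
  unfolding Union_E
  using closedin_extended_reals closedin_upper_arcs closedin_reflect by (intro closedin_Un) auto

lemma reflect_Union_E: "reflect ` \<Union>E = \<Union>E"
proof -
  have "reflect ` extended_reals = extended_reals"
    using reflect_extended_reals by (simp cong: image_cong)
  then show ?thesis unfolding Union_E image_Un by auto
qed

lemmas face_open = openin_complement_component[OF closedin_Union_E, folded faces_def]
  and face_connected = connectedin_complement_component[OF closedin_Union_E, folded faces_def]
  and face_nonempty = complement_component_nonempty[OF closedin_Union_E, folded faces_def]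
  and face_disjoint = complement_component_disjoint[OF closedin_Union_E, folded faces_def]
  and face_maximal = complement_component_maximal[of _ "\<Union>E", folded faces_def]
  and face_eq = complement_component_eq[of _ "\<Union>E", folded faces_def]
  and frontier_face = frontier_complement_component[OF closedin_Union_E, folded faces_def]
  and reflect_face = reflect_complement_component[OF closedin_Union_E reflect_Union_E, folded faces_def]

lemma face_superset:
  assumes "connectedin riemann_sphere S" "S \<inter> \<Union>E = {}" "S \<noteq> {}"
  obtains f where "f \<in> faces E" "S \<subseteq> f"
  using complement_component_superset[OF assms] unfolding faces_def by metis

lemma face_half_plane:
  assumes "f \<in> faces E"
  shows "f \<subseteq> upper_half_plane \<or> f \<subseteq> lower_half_plane"
proof (rule ccontr)
  assume *: "\<not> ?thesis"
  have f: "f \<subseteq> upper_half_plane \<union> lower_half_plane"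
    using face_disjoint[OF assms] half_plane_cases unfolding Union_E by blast
  with * have "upper_half_plane \<inter> f \<noteq> {}" "lower_half_plane \<inter> f \<noteq> {}" by blast+
  moreover have "upper_half_plane \<inter> lower_half_plane \<inter> f = {}" using half_planes_disjoint by blast
  ultimately show False
    using face_connected[OF assms] f openin_half_planes unfolding connectedin by metis
qed

lemma reflect_lower: "f \<subseteq> lower_half_plane \<Longrightarrow> reflect ` f \<subseteq> upper_half_plane"
  by auto

section \<open>Incidence and the local picture along the real line\<close>

lemma incidentI:
  assumes "f \<in> faces E" "e \<in> E" "e \<subseteq> cl f"
  shows "incident f e"
  using assms face_disjoint[OF assms(1)] unfolding incident_def frontier_of_openin[OF face_open[OF assms(1)]]
  by blast

lemma incident_reflect: "incident f e \<Longrightarrow> incident (reflect ` f) (reflect ` e)"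
  unfolding incident_def frontier_of_reflect by (rule image_mono)

text \<open>Reflection fixes a real segment pointwise, so one edge borders both a face and its
  mirror image. At this edge the alternating condition compares their colors.\<close>

lemma incident_reflect_segment:
  assumes "e \<in> real_segments V" "incident f e"
  shows "incident (reflect ` f) e"
proof -
  have "reflect ` e = id ` e"
    using real_segment_subset[OF assms(1)] reflect_extended_reals by (intro image_cong) auto
  then show ?thesis using incident_reflect[OF assms(2)] by simp
qed

text \<open>Off the vertices a real point has a neighbourhood that meets neither an upper arc nor
  the mirror image of one, so each of its half discs lies in a single face.\<close>

lemma half_discs:
  assumes "x \<in> extended_reals - V" "openin riemann_sphere T" "x \<in> T"
  obtains N f where "openin riemann_sphere N" "x \<in> N" "N \<subseteq> T" "f \<in> faces E" "f \<subseteq> upper_half_plane"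
    "x \<in> cl f" "N \<inter> upper_half_plane \<subseteq> f" "N \<inter> lower_half_plane \<subseteq> reflect ` f"
proof -
  let ?K = "upper_arcs \<union> reflect ` upper_arcs"
  have x: "x \<in> extended_reals" "x \<notin> ?K"
    using assms(1) upper_arcs_subset lower_arcs_subset half_planes_disjoint by blast+
  have "openin riemann_sphere (- ?K)"
    using closedin_upper_arcs closedin_reflect closedin_Un unfolding openin_Compl_iff_closedin by blast
  then have "openin riemann_sphere (T \<inter> - ?K)" "x \<in> T \<inter> - ?K"
    using assms(2,3) x by auto
  then obtain N where N: "openin riemann_sphere N" "x \<in> N" "N \<subseteq> T \<inter> - ?K"
    "connectedin riemann_sphere (N \<inter> upper_half_plane)"
    "connectedin riemann_sphere (N \<inter> lower_half_plane)"
    "N \<inter> upper_half_plane \<noteq> {}" "N \<inter> lower_half_plane \<noteq> {}"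
    using sphere_disc_neighbourhood x(1) by metis
  have "N \<inter> upper_half_plane \<inter> \<Union>E = {}" "N \<inter> lower_half_plane \<inter> \<Union>E = {}"
    unfolding Union_E using N(3) half_planes_disjoint by blast+
  then obtain f f' where f: "f \<in> faces E" "N \<inter> upper_half_plane \<subseteq> f"
    and f': "f' \<in> faces E" "N \<inter> lower_half_plane \<subseteq> f'"
    using N(4-7) face_superset by metis
  have "f \<subseteq> upper_half_plane"
    using face_half_plane[OF f(1)] f(2) N(6) half_planes_disjoint(1) by blast
  moreover have "f' = reflect ` f"
  proof (rule face_eq[OF f'(1) reflect_face[OF f(1)]])
    \<comment> \<open>\<open>N\<close> need not be symmetric, but \<open>x\<close> is fixed by the
      reflection, so \<open>N\<close> and its mirror image share a neighbourhood of
      \<open>x\<close>. A point of it below the real line shows that the lower face is the reflected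
      upper face.\<close>
    have "openin riemann_sphere (N \<inter> reflect ` N)" using N(1) by (simp add: openin_Int openin_reflect)
    moreover have "x \<in> N \<inter> reflect ` N"
      using N(2) reflect_extended_reals[OF x(1)] by (metis IntI imageI)
    ultimately obtain y where "y \<in> N" "y \<in> reflect ` N" "y \<in> lower_half_plane"
      using extended_reals_neighbourhood(2)[OF _ _ x(1)] by blast
    then have "y \<in> f'" "reflect y \<in> f" using f f' by auto
    then show "f' \<inter> reflect ` f \<noteq> {}" by (metis IntI empty_iff reflect_image_iff)
  qed
  moreover have "x \<in> cl f"
    unfolding in_closure_of_riemann_sphere
  proof (intro allI impI)
    fix T' assume "openin riemann_sphere T' \<and> x \<in> T'"
    then have "openin riemann_sphere (T' \<inter> N)" "x \<in> T' \<inter> N" using N(1,2) by auto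
    then show "f \<inter> T' \<noteq> {}" using extended_reals_neighbourhood(1) x(1) f(2) by blast
  qed
  ultimately show thesis using that[of N f] N(1-3) f f' by blast
qed

text \<open>By \<open>half_discs\<close> only one face and its mirror image occur near
  \<open>x\<close>, so \<open>f\<close> is one of them. Real points of \<open>N\<close> are
  approached from both half discs, hence also by \<open>f\<close>.\<close>

lemma face_near_real_point:
  assumes "f \<in> faces E" "x \<in> extended_reals - V" "x \<in> cl f" "openin riemann_sphere T" "x \<in> T"
  obtains N where "openin riemann_sphere N" "x \<in> N" "N \<subseteq> T"
    "f \<subseteq> upper_half_plane \<and> N \<inter> upper_half_plane \<subseteq> f \<or> f \<subseteq> lower_half_plane \<and> N \<inter> lower_half_plane \<subseteq> f"
    "N \<inter> extended_reals \<subseteq> cl f"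
proof -
  obtain N g where N: "openin riemann_sphere N" "x \<in> N" "N \<subseteq> T" "g \<in> faces E" "g \<subseteq> upper_half_plane"
    "N \<inter> upper_half_plane \<subseteq> g" "N \<inter> lower_half_plane \<subseteq> reflect ` g"
    using half_discs[OF assms(2,4,5)] by metis
  obtain y where y: "y \<in> f" "y \<in> N"
    using assms(3) N(1,2) unfolding in_closure_of_riemann_sphere by blast
  have *: "f \<subseteq> upper_half_plane \<and> N \<inter> upper_half_plane \<subseteq> f \<or> f \<subseteq> lower_half_plane \<and> N \<inter> lower_half_plane \<subseteq> f"
    using face_half_plane[OF assms(1)]
  proof
    assume "f \<subseteq> upper_half_plane"
    then have "f \<inter> g \<noteq> {}" using y N(6) by blast
    then show ?thesis using face_eq[OF assms(1) N(4)] N(6) \<open>f \<subseteq> upper_half_plane\<close> by blast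
  next
    assume "f \<subseteq> lower_half_plane"
    then have "f \<inter> reflect ` g \<noteq> {}" using y N(7) by blast
    then show ?thesis using face_eq[OF assms(1) reflect_face[OF N(4)]] N(7) \<open>f \<subseteq> lower_half_plane\<close> by blast
  qed
  have "N \<inter> extended_reals \<subseteq> cl f"
  proof
    fix z assume z: "z \<in> N \<inter> extended_reals"
    show "z \<in> cl f"
      unfolding in_closure_of_riemann_sphere
    proof (intro allI impI)
      fix T' assume "openin riemann_sphere T' \<and> z \<in> T'"
      then have "openin riemann_sphere (T' \<inter> N)" "z \<in> T' \<inter> N" "z \<in> extended_reals"
        using N(1) z by auto
      from extended_reals_neighbourhood[OF this] * show "f \<inter> T' \<noteq> {}"
        by (elim disjE conjE) blast+
    qed
  qed
  then show thesis using that N * by blast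
qed

text \<open>Along the real line without the vertices, the closure of a face is relatively open as
  well as closed, so a connected set cannot leave it.\<close>

lemma closure_face_real:
  assumes "f \<in> faces E" "connectedin riemann_sphere S" "S \<subseteq> extended_reals - V" "x \<in> S" "x \<in> cl f"
  shows "S \<subseteq> cl f"
proof (rule ccontr)
  assume *: "\<not> S \<subseteq> cl f"
  define U where "U = \<Union>{N. openin riemann_sphere N \<and> N \<inter> extended_reals \<subseteq> cl f}"
  have "openin riemann_sphere U" unfolding U_def by (intro openin_Union) blast
  moreover have "openin riemann_sphere (- cl f)" by (simp add: openin_Compl_iff_closedin)
  moreover have "y \<in> U" if "y \<in> S" "y \<in> cl f" for y
    using face_near_real_point[OF assms(1) _ that(2) openin_topspace] that(1) assms(3)
    unfolding U_def by (metis (mono_tags, lifting) UNIV_I UnionI mem_Collect_eq subsetD topspace_riemann_sphere)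
  then have "S \<subseteq> U \<union> - cl f" "U \<inter> S \<noteq> {}" using assms(4,5) by blast+
  moreover have "U \<inter> - cl f \<inter> S = {}" using assms(3) unfolding U_def by blast
  moreover have "- cl f \<inter> S \<noteq> {}" using * by blast
  ultimately show False using assms(2) unfolding connectedin by metis
qed

lemma segment_interior:
  assumes "e \<in> real_segments V"
  obtains S where "connectedin riemann_sphere S" "S = e - V" "e \<subseteq> cl S" "infinite S"
proof -
  obtain g where g: "sphere_arc g" "curve_image g \<subseteq> extended_reals" "g 0 \<in> V" "g 1 \<in> V"
    "g ` {0<..<1} \<inter> V = {}" "e = curve_image g"
    using assms by (auto simp: real_segments_def)
  have cont: "continuous_map (top_of_set {0..1}) riemann_sphere g" and inj: "inj_on g {0..1}"
    using g(1) by (auto simp: sphere_arc_def pathin_def)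
  have "connectedin (top_of_set {0..1::real}) {0<..<1}"
    by (auto simp: connectedin_subtopology)
  then have "connectedin riemann_sphere (g ` {0<..<1})"
    using connectedin_continuous_map_image[OF cont] by blast
  moreover have "g ` {0<..<1} = e - V" using g(3-6) by (auto simp: unit_interval_split)
  moreover have "e \<subseteq> cl (g ` {0<..<1})"
  proof -
    have "top_of_set {0..1::real} closure_of {0<..<1} = {0..1}"
      by (auto simp: closure_of_subtopology Int_absorb1 greaterThanLessThan_subseteq_atLeastAtMost_iff)
    then show ?thesis using continuous_map_image_closure_subset[OF cont, of "{0<..<1}"] g(6) by simp
  qed
  moreover have "infinite (g ` {0<..<1})"
    using inj by (subst finite_image_iff) (auto intro: inj_on_subset)
  ultimately show thesis using that by metis
qed

text \<open>One contact point off the vertices suffices: contact spreads over the connected interior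
  of the segment, and the ends are limits of it.\<close>

lemma segment_incident:
  assumes "f \<in> faces E" "e \<in> real_segments V" "x \<in> e - V" "x \<in> cl f"
  shows "incident f e"
proof -
  obtain S where S: "connectedin riemann_sphere S" "S = e - V" "e \<subseteq> cl S"
    using segment_interior[OF assms(2)] by metis
  have "S \<subseteq> cl f"
    using S(1,2) assms real_segment_subset[OF assms(2)] by (intro closure_face_real[OF assms(1) S(1), of x]) auto
  then have "cl S \<subseteq> cl f" by (simp add: closure_of_minimal)
  then show ?thesis using S(3) assms(2) by (intro incidentI[OF assms(1)]) (auto simp: E_def)
qed

text \<open>Otherwise the frontier of an upper face would lie in the union of the disjoint upper arcs,
  which does not separate the sphere.\<close>

lemma upper_face_real_point:
  assumes "f \<in> faces E" "f \<subseteq> upper_half_plane"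
  shows "\<exists>x\<in>extended_reals - V. x \<in> cl f"
proof (rule ccontr)
  assume no: "\<not> ?thesis"
  \<comment> \<open>An upper face does not approach the lower half-plane. Without real contact off
    \<open>V\<close>, its frontier is left with the upper arcs, which contain
    \<open>V\<close>.\<close>
  have "cl f \<subseteq> - lower_half_plane"
    using assms(2) half_planes_disjoint(1) openin_half_planes(2)
    by (intro closure_of_minimal) (auto simp: closedin_def Compl_eq_Diff_UNIV double_diff)
  then have fr: "riemann_sphere frontier_of f \<subseteq> upper_arcs"
    using no frontier_face[OF assms(1)] lower_arcs_subset V_subset_arcs
    unfolding Union_E frontier_of_openin[OF face_open[OF assms(1)]] by blast
  have "\<forall>m\<in>M. \<exists>g. sphere_arc g \<and> \<alpha> m = curve_image g"
    by (meson upper_arcE)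
  from bchoice[OF this] obtain g where
    g: "\<And>m. m \<in> M \<Longrightarrow> sphere_arc (g m)" "\<And>m. m \<in> M \<Longrightarrow> \<alpha> m = curve_image (g m)"
    by blast
  \<comment> \<open>The point \<open>- \<i>\<close> serves twice: as the point omitted by the chart,
    being off the arcs, and as a point of the complement of the arcs outside
    \<open>f\<close>.\<close>
  have "Some (- \<i>) \<notin> extended_reals" "Some (- \<i>) \<notin> upper_half_plane"
    by (simp_all add: extended_reals_iff)
  then have q: "Some (- \<i>) \<notin> upper_arcs"
    using upper_arcs_subset V(1) by blast
  have "connectedin riemann_sphere (- (\<Union>m\<in>M. curve_image (g m)))"
  proof (rule sphere_compl_disjoint_arcs_connected[where q = "- \<i>"])
    show "disjoint_family_on (\<lambda>m. curve_image (g m)) M"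
      using disjoint g(2) by (simp add: disjoint_family_on_def)
    show "Some (- \<i>) \<notin> curve_image (g m)" if "m \<in> M" for m
      using q g(2) that by (auto simp: upper_arcs_def)
  qed (use finite_M g in auto)
  then have "connectedin riemann_sphere (- upper_arcs)"
    using g(2) by (simp add: upper_arcs_def)
  moreover have "- upper_arcs \<inter> f \<noteq> {}"
    using face_disjoint[OF assms(1)] face_nonempty[OF assms(1)] unfolding Union_E by blast
  moreover have "Some (- \<i>) \<in> - upper_arcs - f" using q assms(2) by auto
  then have "- upper_arcs - f \<noteq> {}" by blast
  ultimately show False using connectedin_Int_frontier_of fr by blast
qed

text \<open>Contact at infinity spreads to nearby real points. A finite contact point allows faces
  to be compared by the order of the reals when they are counted.\<close>

lemma face_real_point:
  assumes "f \<in> faces E"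
  obtains r where "Some (complex_of_real r) \<in> cl f" "Some (complex_of_real r) \<notin> V"
proof -
  obtain x where x: "x \<in> extended_reals - V" "x \<in> cl f"
  proof (cases "f \<subseteq> upper_half_plane")
    case True
    then show ?thesis using upper_face_real_point[OF assms] that by blast
  next
    case False
    then have "reflect ` f \<subseteq> upper_half_plane"
      using face_half_plane[OF assms] reflect_lower by blast
    then obtain x where x: "x \<in> extended_reals - V" "x \<in> cl (reflect ` f)"
      using upper_face_real_point reflect_face[OF assms] by blast
    then have "reflect x \<in> cl f" unfolding closure_of_reflect by auto
    then show ?thesis using that x reflect_extended_reals by auto
  qed
  have "closedin riemann_sphere V"
    using V(2) Hausdorff_imp_t1_space[OF Hausdorff_riemann_sphere]
    unfolding t1_space_closedin_finite by simp
  then have op: "openin riemann_sphere (- V)" by (simp add: openin_Compl_iff_closedin)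
  obtain N where N: "openin riemann_sphere N" "x \<in> N" "N \<subseteq> - V" "N \<inter> extended_reals \<subseteq> cl f"
    using face_near_real_point[OF assms x op] x by (metis ComplI DiffD2)
  have "\<exists>r. Some (complex_of_real r) \<in> N"
  proof (cases x)
    case None
    then obtain B where B: "\<And>z. z \<in> - (Some -` N) \<Longrightarrow> norm z \<le> B"
      using N(1,2) by (auto simp: openin_riemann_sphere bounded_iff)
    have "complex_of_real (\<bar>B\<bar> + 1) \<in> Some -` N"
      using B[of "complex_of_real (\<bar>B\<bar> + 1)"] by (metis ComplI abs_ge_self abs_of_nonneg abs_ge_zero
          add_nonneg_nonneg linorder_not_less norm_of_real order_le_less_trans less_add_one zero_le_one)
    then show ?thesis by blast
  next
    case (Some z)
    then show ?thesis using x(1) N(2) by (auto elim!: extended_reals_cases)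
  qed
  then obtain r where "Some (complex_of_real r) \<in> N" by blast
  moreover have "Some (complex_of_real r) \<in> extended_reals" by (simp add: extended_reals_iff)
  ultimately show thesis using that N(3,4) by blast
qed

section \<open>Colors and the number of faces\<close>

lemma face_segment:
  assumes "f \<in> faces E"
  obtains e r where "e \<in> real_segments V" "Some (complex_of_real r) \<in> e - V"
    "Some (complex_of_real r) \<in> cl f" "incident f e"
proof -
  obtain r where r: "Some (complex_of_real r) \<in> cl f" "Some (complex_of_real r) \<notin> V"
    using face_real_point[OF assms] by blast
  then obtain e where "e \<in> real_segments V" "Some (complex_of_real r) \<in> e"
    using real_segment_through[OF V(2,3,1)] by (metis DiffI Im_complex_of_real extended_reals_iff(1))
  then show thesis using that r segment_incident[OF assms] by blast
qed

lemma reflect_face_ne: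
  assumes "f \<in> faces E"
  shows "f \<noteq> reflect ` f"
proof
  assume eq: "f = reflect ` f"
  obtain y where y: "y \<in> f" using face_nonempty[OF assms] by blast
  then have "reflect y \<in> f" using eq by blast
  then show False
    using y face_half_plane[OF assms] half_planes_disjoint(1) reflect_half_plane(1,2)[of y] by blast
qed

lemma alternating_reflect:
  assumes "alternating_coloring E A" "f \<in> faces E"
  shows "reflect ` f \<in> A \<longleftrightarrow> f \<notin> A"
proof -
  obtain e where e: "e \<in> real_segments V" "incident f e" using face_segment[OF assms(2)] by metis
  have "e \<in> E" using e(1) by (simp add: E_def)
  then show ?thesis
    using assms reflect_face[OF assms(2)] reflect_face_ne[OF assms(2)] e incident_reflect_segment[OF e]
    unfolding alternating_coloring_def by metis
qed

text \<open>Both faces contain the upper half of one neighbourhood of \<open>x\<close>, the second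
  neighbourhood being chosen inside the first.\<close>

lemma upper_faces_eq:
  assumes f: "f \<in> faces E" "f \<subseteq> upper_half_plane" and g: "g \<in> faces E" "g \<subseteq> upper_half_plane"
    and x: "x \<in> extended_reals - V" "x \<in> cl f" "x \<in> cl g"
  shows "f = g"
proof -
  have up: "\<not> f \<subseteq> lower_half_plane" "\<not> g \<subseteq> lower_half_plane"
    using f g face_nonempty half_planes_disjoint(1) by blast+
  obtain N where N: "openin riemann_sphere N" "x \<in> N" "N \<inter> upper_half_plane \<subseteq> f"
    using face_near_real_point[OF f(1) x(1,2) openin_topspace] up by (metis UNIV_I topspace_riemann_sphere)
  obtain N' where N': "openin riemann_sphere N'" "x \<in> N'" "N' \<subseteq> N" "N' \<inter> upper_half_plane \<subseteq> g"
    using face_near_real_point[OF g(1) x(1,3) N(1,2)] up by metis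
  have "N' \<inter> upper_half_plane \<noteq> {}"
    using extended_reals_neighbourhood(1)[OF N'(1,2)] x(1) by blast
  then have "f \<inter> g \<noteq> {}" using N(3) N'(3,4) by blast
  then show ?thesis using face_eq f g by blast
qed

text \<open>An upper face is determined by the set of finite vertices to the left of a chosen real
  contact point: equal sets leave no vertex between two contact points, so contact spreads from one
  to the other. Lower faces are mirror images. Finiteness gives \<open>card\<close> its meaning in
  the final count and isolates a single face at a limit point.\<close>

lemma finite_faces: "finite (faces E)"
proof -
  define X where "X = {v. Some (complex_of_real v) \<in> V}"
  have "finite X"
  proof -
    have "finite ((\<lambda>v. Some (complex_of_real v)) -` V)"
      using V(2) by (rule finite_vimageI) (auto simp: inj_def)
    then show ?thesis by (simp add: X_def vimage_def)
  qed
  have "\<forall>f\<in>faces E. \<exists>r. Some (complex_of_real r) \<in> cl f \<and> Some (complex_of_real r) \<notin> V"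
    using face_real_point by blast
  from bchoice[OF this] obtain r where
    r: "\<And>f. f \<in> faces E \<Longrightarrow> Some (complex_of_real (r f)) \<in> cl f"
      "\<And>f. f \<in> faces E \<Longrightarrow> Some (complex_of_real (r f)) \<notin> V"
    by blast
  let ?U = "{f \<in> faces E. f \<subseteq> upper_half_plane}"
  have le: "f = g" if fg: "f \<in> ?U" "g \<in> ?U" and le: "r f \<le> r g"
    and eq: "{v \<in> X. v < r f} = {v \<in> X. v < r g}" for f g
  proof -
    let ?S = "(\<lambda>x. Some (complex_of_real x)) ` {r f..r g}"
    have "connected (complex_of_real ` {r f..r g})"
      by (intro connected_continuous_image continuous_intros) auto
    then have "connectedin riemann_sphere (Some ` complex_of_real ` {r f..r g})"
      by (rule connectedin_Some_image)
    then have con: "connectedin riemann_sphere ?S" by (simp add: image_image)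
    \<comment> \<open>Contact points are not vertices, so a vertex between them would lie to the
      left of \<open>r g\<close> but not of \<open>r f\<close>.\<close>
    have "v \<notin> X" if "v \<in> {r f..r g}" for v
    proof
      assume "v \<in> X"
      then have "v \<noteq> r f" "v \<noteq> r g" using r(2) fg by (auto simp: X_def)
      then have "v < r g" "\<not> v < r f" using that by auto
      then show False using eq \<open>v \<in> X\<close> by blast
    qed
    then have S: "?S \<subseteq> extended_reals - V" by (auto simp: X_def extended_reals_iff)
    have "Some (complex_of_real (r f)) \<in> ?S" "Some (complex_of_real (r g)) \<in> ?S" using le by auto
    moreover have "f \<in> faces E" using fg by blast
    ultimately have "Some (complex_of_real (r g)) \<in> cl f"
      using closure_face_real[OF _ con S _ r(1)] by blast
    then show "f = g"
      using upper_faces_eq[of f g "Some (complex_of_real (r g))"] r fg by (auto simp: extended_reals_iff)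
  qed
  have "inj_on (\<lambda>f. {v \<in> X. v < r f}) ?U"
  proof (rule inj_onI)
    fix f g assume "f \<in> ?U" "g \<in> ?U" "{v \<in> X. v < r f} = {v \<in> X. v < r g}"
    then show "f = g" using le[of f g] le[of g f] by (cases "r f \<le> r g") auto
  qed
  moreover have "finite ((\<lambda>f. {v \<in> X. v < r f}) ` ?U)"
    by (rule finite_subset[of _ "Pow X"]) (use \<open>finite X\<close> in auto)
  ultimately have fin: "finite ?U" by (rule finite_imageD[rotated])
  have "f \<in> ?U \<union> (`) reflect ` ?U" if "f \<in> faces E" for f
  proof (cases "f \<subseteq> upper_half_plane")
    case False
    then have "reflect ` f \<in> ?U"
      using face_half_plane[OF that] reflect_lower reflect_face[OF that] by blast
    then have "reflect ` reflect ` f \<in> (`) reflect ` ?U" by (rule imageI)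
    then show ?thesis by simp
  qed (use that in auto)
  then have "faces E \<subseteq> ?U \<union> (`) reflect ` ?U" by blast
  moreover have "finite (?U \<union> (`) reflect ` ?U)" using fin by blast
  ultimately show ?thesis by (rule finite_subset)
qed

end

text \<open>Charts omit a finite point; this provides one inside the region \<open>R\<close>, even
  when \<open>R\<close> contains infinity.\<close>

lemma openin_finite_point:
  assumes "openin riemann_sphere T" "T \<noteq> {}"
  obtains q where "Some q \<in> T"
proof (cases "None \<in> T")
  case True
  then obtain y where "y \<in> T" "y \<in> upper_half_plane"
    using extended_reals_neighbourhood(1)[OF assms(1)] extended_reals_iff(2) by blast
  then show thesis using that by (cases y) auto
next
  case False
  then show thesis using assms(2) that by (metis all_not_in_conv not_None_eq)
qed

lemma openin_off_extended_reals:
  assumes "openin riemann_sphere T" "T \<noteq> {}"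
  shows "T \<inter> (upper_half_plane \<union> lower_half_plane) \<noteq> {}"
  using extended_reals_neighbourhood(1)[OF assms(1)] assms(2) half_plane_cases by blast

section \<open>Reflecting the faces of a multicycle\<close>

context real_graph
begin

lemma edge_through_real_point:
  assumes "e \<in> E" "x \<in> e" "x \<in> extended_reals - V"
  shows "e \<in> real_segments V"
proof -
  have "x \<notin> upper_arcs" "x \<notin> reflect ` upper_arcs"
    using assms(3) upper_arcs_subset lower_arcs_subset half_planes_disjoint by blast+
  then show ?thesis using assms(1,2) by (auto simp: E_def upper_arcs_def)
qed

lemma reflect_arc_subset: "m \<in> M \<Longrightarrow> reflect ` \<alpha> m \<subseteq> m \<union> lower_half_plane"
proof
  fix x assume m: "m \<in> M" and "x \<in> reflect ` \<alpha> m"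
  then have "reflect x \<in> m \<union> upper_half_plane" using arc_subset[OF m] by auto
  then show "x \<in> m \<union> lower_half_plane"
  proof
    assume *: "reflect x \<in> m"
    then have "reflect x = x"
      using reflect_V[of "reflect x"] arc_ends[OF m] by (metis reflect_simps(3) subsetD)
    then show ?thesis using * by simp
  qed simp
qed

lemma arc_Int_reflect_arc:
  assumes "m \<in> M" "m' \<in> M"
  shows "\<alpha> m \<inter> reflect ` \<alpha> m' \<subseteq> m \<inter> m'"
proof
  fix x assume x: "x \<in> \<alpha> m \<inter> reflect ` \<alpha> m'"
  have ext: "m \<subseteq> extended_reals" "m' \<subseteq> extended_reals" using arc_ends assms V(1) by blast+
  have "x \<in> m \<union> upper_half_plane" "x \<in> m' \<union> lower_half_plane"
    using x arc_subset[OF assms(1)] reflect_arc_subset[OF assms(2)] by blast+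
  then show "x \<in> m \<inter> m'" using ext half_planes_disjoint by blast
qed

lemma arc_pairs_disjoint:
  assumes "m \<in> M" "m' \<in> M" "m \<noteq> m'"
  shows "(\<alpha> m \<union> reflect ` \<alpha> m) \<inter> (\<alpha> m' \<union> reflect ` \<alpha> m') = {}"
proof -
  have d: "\<alpha> m \<inter> \<alpha> m' = {}" using disjoint assms by (auto simp: disjoint_family_on_def)
  then have "reflect ` \<alpha> m \<inter> reflect ` \<alpha> m' = {}" by auto
  moreover have "m \<inter> m' = {}" using d arc_ends assms by blast
  moreover have "\<alpha> m \<inter> reflect ` \<alpha> m' = {}" "\<alpha> m' \<inter> reflect ` \<alpha> m = {}"
    using arc_Int_reflect_arc assms(1,2) \<open>m \<inter> m' = {}\<close> by blast+
  ultimately show ?thesis using d by blast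
qed

text \<open>An arc and its mirror image form a closed set, and the sets of different pairs are
  disjoint, so a connected curve stays within one pair. A closed curve is not a single arc, so both
  members of the pair occur.\<close>

lemma cycle_without_segments:
  assumes c: "simple_closed_curve \<gamma>" and E': "E' \<subseteq> E" "curve_image \<gamma> = \<Union>E'"
    and no: "E' \<inter> real_segments V = {}" and q: "Some q \<notin> curve_image \<gamma>"
  obtains m where "m \<in> M" "\<alpha> m \<subseteq> curve_image \<gamma>" "reflect ` \<alpha> m \<subseteq> curve_image \<gamma>"
proof -
  let ?P = "\<lambda>m. \<alpha> m \<union> reflect ` \<alpha> m"
  have arcs': "\<exists>m\<in>M. e = \<alpha> m \<or> e = reflect ` \<alpha> m" if "e \<in> E'" for e
  proof -
    have "e \<in> E" "e \<notin> real_segments V" using that E'(1) no by blast+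
    then show ?thesis by (auto simp: E_def)
  qed
  have ne: "m \<noteq> {}" if "m \<in> M" for m
    using matching that by (auto simp: perfect_matching_def)
  have "curve_image \<gamma> \<noteq> {}" by simp
  then obtain e where "e \<in> E'" "e \<noteq> {}" using E'(2) by blast
  have E'_curve: "e' \<subseteq> curve_image \<gamma>" if "e' \<in> E'" for e'
    unfolding E'(2) using that by (rule Union_upper)
  obtain m where m: "m \<in> M" "e = \<alpha> m \<or> e = reflect ` \<alpha> m" using arcs'[OF \<open>e \<in> E'\<close>] by blast
  then have "e \<subseteq> ?P m" by auto
  then have meets: "?P m \<inter> curve_image \<gamma> \<noteq> {}"
    using E'_curve[OF \<open>e \<in> E'\<close>] \<open>e \<noteq> {}\<close> by blast
  let ?Q = "\<Union>m'\<in>M - {m}. ?P m'"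
  have cl: "closedin riemann_sphere (?P m')" if "m' \<in> M" for m'
    using closedin_arc[OF that] closedin_reflect by (intro closedin_Un) auto
  have cl_Q: "closedin riemann_sphere ?Q"
  proof (rule closedin_Union)
    show "finite (?P ` (M - {m}))" using finite_M by blast
    show "closedin riemann_sphere S" if S: "S \<in> ?P ` (M - {m})" for S
    proof -
      obtain m' where m': "m' \<in> M" "S = ?P m'" using S by blast
      show ?thesis unfolding m'(2) by (rule cl[OF m'(1)])
    qed
  qed
  have P_Q: "?P m \<inter> ?Q = {}"
  proof -
    have "?P m \<inter> ?P m' = {}" if "m' \<in> M - {m}" for m'
      using that by (intro arc_pairs_disjoint[OF m(1)]) auto
    then show ?thesis by blast
  qed
  have sub: "curve_image \<gamma> \<subseteq> ?P m \<union> ?Q"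
    unfolding E'(2)
  proof
    fix x assume "x \<in> \<Union>E'"
    then obtain e' where "e' \<in> E'" "x \<in> e'" by blast
    then obtain m' where "m' \<in> M" "x \<in> ?P m'" using arcs'[of e'] by auto
    then show "x \<in> ?P m \<union> ?Q" by (cases "m' = m") auto
  qed
  have "connectedin riemann_sphere (curve_image \<gamma>)"
    using c by (simp add: simple_closed_curve_def connectedin_curve_image)
  then have con: "\<not> (closedin riemann_sphere S \<and> closedin riemann_sphere T \<and> curve_image \<gamma> \<subseteq> S \<union> T \<and>
      S \<inter> T \<inter> curve_image \<gamma> = {} \<and> S \<inter> curve_image \<gamma> \<noteq> {} \<and> T \<inter> curve_image \<gamma> \<noteq> {})" for S T
    unfolding connectedin_closedin by blast
  have Q: "?Q \<inter> curve_image \<gamma> = {}"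
  proof (rule ccontr)
    assume "?Q \<inter> curve_image \<gamma> \<noteq> {}"
    moreover have "?P m \<inter> ?Q \<inter> curve_image \<gamma> = {}" unfolding P_Q by (rule Int_empty_left)
    ultimately show False using con[of "?P m" ?Q] cl[OF m(1)] cl_Q sub meets by satx
  qed
  have E'_sub: "e' = \<alpha> m \<or> e' = reflect ` \<alpha> m" if e': "e' \<in> E'" for e'
  proof -
    obtain m' where m': "m' \<in> M" "e' = \<alpha> m' \<or> e' = reflect ` \<alpha> m'" using arcs'[OF e'] by blast
    then have "e' \<noteq> {}" using arc_ends[OF m'(1)] ne[OF m'(1)] by auto
    then obtain z where "z \<in> e'" by blast
    then have "z \<in> curve_image \<gamma>" "z \<in> ?P m'" using E'_curve[OF e'] m'(2) by auto
    then have "m' = m" using Q m'(1) by blast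
    then show ?thesis using m'(2) by simp
  qed
  obtain g where g: "sphere_arc g" "\<alpha> m = curve_image g" using upper_arcE[OF m(1)] by metis
  have "sphere_arc (reflect \<circ> g)"
    using g(1) continuous_map_compose[OF _ homeomorphic_imp_continuous_map[OF homeomorphic_map_reflect]]
    by (auto simp: sphere_arc_def pathin_def inj_on_def)
  moreover have "reflect ` \<alpha> m = curve_image (reflect \<circ> g)" by (simp add: g(2) image_comp)
  ultimately have not_arc: "\<Union>E' \<noteq> \<alpha> m" "\<Union>E' \<noteq> reflect ` \<alpha> m"
    using sphere_arc_not_closed_curve[OF c _ q] g unfolding E'(2) by metis+
  have "\<alpha> m \<in> E'"
  proof (rule ccontr)
    assume "\<alpha> m \<notin> E'"
    then have "E' = {reflect ` \<alpha> m}" using E'_sub \<open>e \<in> E'\<close> by blast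
    then show False using not_arc by simp
  qed
  moreover have "reflect ` \<alpha> m \<in> E'"
  proof (rule ccontr)
    assume "reflect ` \<alpha> m \<notin> E'"
    then have "E' = {\<alpha> m}" using E'_sub \<open>e \<in> E'\<close> by blast
    then show False using not_arc by simp
  qed
  ultimately show thesis using that[OF m(1)] E'_curve by blast
qed

lemma locally_balanced:
  assumes A: "alternating_coloring E A"
  shows "locally_balanced E A"
  unfolding locally_balanced_def
proof (intro allI impI, elim conjE)
  fix L R assume "positive_cobordant_multicycle E A L" "multicycle_interior L R"
  define K where "K = (\<Union>\<gamma>\<in>L. curve_image \<gamma>)"
  have R: "R \<in> complement_components K" "riemann_sphere frontier_of R = K"
    and left: "\<And>\<gamma>. \<gamma> \<in> L \<Longrightarrow> R \<subseteq> left_side \<gamma>"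
    using \<open>multicycle_interior L R\<close> by (auto simp: multicycle_interior_def cobounds_def K_def)
  have L: "finite L" "\<And>\<gamma>. \<gamma> \<in> L \<Longrightarrow> positive_cycle E A \<gamma>"
    "\<not> connected_space (subtopology riemann_sphere (topspace riemann_sphere - K))"
    using \<open>positive_cobordant_multicycle E A L\<close>
    by (auto simp: positive_cobordant_multicycle_def cobordant_multicycle_def K_def)
  have cyc: "simple_closed_curve \<gamma>" "\<exists>E'\<subseteq>E. curve_image \<gamma> = \<Union>E'" if "\<gamma> \<in> L" for \<gamma>
    using L(2)[OF that] by (auto simp: positive_cycle_def cycle_def)
  have K_sub: "K \<subseteq> \<Union>E" using cyc(2) unfolding K_def by blast
  have "closedin riemann_sphere K"
    unfolding K_def using L(1) cyc(1) closedin_curve_image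
    by (intro closedin_Union) (auto simp: simple_closed_curve_def)
  note R_facts = complement_components_facts[OF this R(1)]
  \<comment> \<open>\<open>R\<close> is open, so every point of a cycle is a limit of
    \<open>R\<close>, and every limit of \<open>R\<close> off the cycles belongs to
    \<open>R\<close>.\<close>
  have cl_R: "cl R - R = K" using R(2) frontier_of_openin[OF R_facts(1)] by simp
  have face_in: "f \<subseteq> R" if "f \<in> faces E" "f \<inter> R \<noteq> {}" for f
    using complement_component_maximal[OF R(1) face_connected[OF that(1)]] face_disjoint[OF that(1)] K_sub that(2)
    by blast
  \<comment> \<open>The interior lies to the left of every cycle, so positivity applies to each face
    of \<open>R\<close> that borders an edge of a cycle.\<close>
  have pos: "f \<in> A" if "\<gamma> \<in> L" "e \<in> E" "e \<subseteq> curve_image \<gamma>" "f \<in> faces E" "incident f e" "f \<subseteq> R" for \<gamma> e f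
    using L(2)[OF that(1)] left[OF that(1)] that by (auto simp: positive_cycle_def)

  have B_reflect: "reflect ` b \<subseteq> R" if b: "b \<in> faces E" "b \<notin> A" "b \<subseteq> R" for b
  proof -
    obtain e r where e: "e \<in> real_segments V" "Some (complex_of_real r) \<in> e - V"
      "Some (complex_of_real r) \<in> cl b"
      using face_segment[OF b(1)] by metis
    define x where "x = Some (complex_of_real r)"
    have x: "x \<in> extended_reals - V" "x \<in> cl b" using e by (auto simp: x_def extended_reals_iff)
    \<comment> \<open>Only real segments pass through a real point off the vertices. If
      \<open>x\<close> were on a cycle, contact at \<open>x\<close> would make \<open>b\<close>
      border a whole edge of that cycle, forcing \<open>b\<close> into \<open>A\<close>.\<close>
    have "x \<notin> K"
    proof
      assume "x \<in> K"
      then obtain \<gamma> where \<gamma>: "\<gamma> \<in> L" "x \<in> curve_image \<gamma>" by (auto simp: K_def)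
      then obtain e' where e': "e' \<in> E" "e' \<subseteq> curve_image \<gamma>" "x \<in> e'" using cyc(2)[OF \<gamma>(1)] by blast
      then have "incident b e'"
        using segment_incident[OF b(1) edge_through_real_point[OF e'(1,3) x(1)]] x by blast
      then show False using pos[OF \<gamma>(1) e'(1,2) b(1)] b by blast
    qed
    moreover have "x \<in> cl R" using x(2) closure_of_mono[OF b(3)] by blast
    ultimately have "x \<in> R" using cl_R by blast
    moreover have "x \<in> cl (reflect ` b)"
      using x reflect_extended_reals unfolding closure_of_reflect by force
    ultimately have "reflect ` b \<inter> R \<noteq> {}"
      using R_facts(1) unfolding in_closure_of_riemann_sphere by blast
    then show ?thesis using face_in reflect_face[OF b(1)] by blast
  qed

  have "\<exists>f. f \<in> faces E \<and> f \<in> A \<and> f \<subseteq> R \<and> \<not> reflect ` f \<subseteq> R"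
  proof (rule ccontr)
    assume "\<not> ?thesis"
    then have sym: "reflect ` f \<subseteq> R" if "f \<in> faces E" "f \<in> A" "f \<subseteq> R" for f
      using that by blast
    have "L \<noteq> {}"
    proof
      assume "L = {}"
      \<comment> \<open>The empty family of arcs: the sphere itself is connected, while the
        complement of a multicycle is not.\<close>
      moreover have "connectedin riemann_sphere (- (\<Union>m\<in>{}. curve_image m))"
        by (rule sphere_compl_disjoint_arcs_connected) (auto simp: disjoint_family_on_def)
      ultimately show False
        using L(3) by (simp add: K_def connectedin_def)
    qed
    then obtain \<gamma> where \<gamma>: "\<gamma> \<in> L" by blast
    then have \<gamma>_sub: "curve_image \<gamma> \<subseteq> K" by (auto simp: K_def)
    obtain q where q: "Some q \<in> R" using openin_finite_point R_facts(1,3) by blast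
    then have q': "Some q \<notin> curve_image \<gamma>" using \<gamma>_sub R_facts(4) by blast
    \<comment> \<open>The omitted point \<open>q\<close> is taken in \<open>R\<close>, so
      \<open>W\<close> lies across the cycle. \<open>R\<close> is connected and misses the cycle,
      hence also \<open>W\<close>, yet both accumulate at every point of the cycle.\<close>
    obtain W where W: "openin riemann_sphere W" "Some q \<notin> W" "riemann_sphere frontier_of W = curve_image \<gamma>"
      using sphere_Jordan[OF cyc(1)[OF \<gamma>] q'] by metis
    have cl_W: "cl W - W = curve_image \<gamma>" using W(3) frontier_of_openin[OF W(1)] by simp
    have WR: "W \<inter> R = {}"
    proof (rule ccontr)
      assume "W \<inter> R \<noteq> {}"
      then have "R \<inter> W \<noteq> {}" "R - W \<noteq> {}" using q W(2) by blast+
      from connectedin_Int_frontier_of[OF R_facts(2) this] show False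
        unfolding W(3) using \<gamma>_sub R_facts(4) by blast
    qed
    from cyc(2)[OF \<gamma>] obtain E' where E': "E' \<subseteq> E" "curve_image \<gamma> = \<Union>E'"
      by (elim exE conjE)
    show False
    proof (cases "E' \<inter> real_segments V = {}")
      case False
      then obtain e where e: "e \<in> E'" "e \<in> real_segments V" by blast
      obtain S where "S = e - V" "infinite S" using segment_interior[OF e(2)] by metis
      then obtain x where x: "x \<in> e - V" by (metis finite.emptyI all_not_in_conv)
      have x_ext: "x \<in> extended_reals - V" using x real_segment_subset[OF e(2)] by blast
      have x_\<gamma>: "x \<in> curve_image \<gamma>" using x e(1) E'(2) by blast
      obtain N f where N: "openin riemann_sphere N" "x \<in> N" "f \<in> faces E" "x \<in> cl f"
        "N \<inter> upper_half_plane \<subseteq> f" "N \<inter> lower_half_plane \<subseteq> reflect ` f"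
        using half_discs[OF x_ext openin_topspace] by (metis UNIV_I topspace_riemann_sphere)
      \<comment> \<open>Off the real line, \<open>N\<close> is filled by \<open>f\<close> and its
        mirror image. This is applied twice: to \<open>R\<close>, putting one of the two faces into
        \<open>R\<close>, and to \<open>W\<close>, which must then meet \<open>R\<close>.\<close>
      have meets: "(f \<union> reflect ` f) \<inter> T \<noteq> {}" if "openin riemann_sphere T" "x \<in> cl T" for T
      proof -
        have "T \<inter> N \<noteq> {}" using that(2) N(1,2) unfolding in_closure_of_riemann_sphere by blast
        then show ?thesis
          using openin_off_extended_reals[OF openin_Int[OF that(1) N(1)]] N(5,6) by blast
      qed
      have inc: "incident f e" using segment_incident[OF N(3) e(2) x N(4)] .
      have eE: "e \<in> E" "e \<subseteq> curve_image \<gamma>" using e(1) E' by auto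
      have "x \<in> cl R" using x_\<gamma> \<gamma>_sub cl_R by blast
      then have "f \<subseteq> R \<or> reflect ` f \<subseteq> R"
        using meets[OF R_facts(1)] face_in[OF N(3)] face_in[OF reflect_face[OF N(3)]] by blast
      then have "f \<subseteq> R \<and> reflect ` f \<subseteq> R"
      proof
        assume "f \<subseteq> R"
        then show ?thesis using sym[OF N(3)] pos[OF \<gamma> eE N(3) inc] by blast
      next
        assume *: "reflect ` f \<subseteq> R"
        then have "reflect ` f \<in> A"
          using pos[OF \<gamma> eE reflect_face[OF N(3)] incident_reflect_segment[OF e(2) inc]] by blast
        then show ?thesis using sym[OF reflect_face[OF N(3)]] * by simp
      qed
      moreover have "x \<in> cl W" using x_\<gamma> cl_W by blast
      ultimately show False using meets[OF W(1)] WR by blast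
    next
      case True
      obtain m where m: "m \<in> M" "\<alpha> m \<subseteq> curve_image \<gamma>" "reflect ` \<alpha> m \<subseteq> curve_image \<gamma>"
        using cycle_without_segments[OF cyc(1)[OF \<gamma>] E' True q'] by blast
      obtain g where g: "sphere_arc g" "{g 0, g 1} = m" "g ` {0<..<1} \<subseteq> upper_half_plane" "\<alpha> m = curve_image g"
        using upper_arcE[OF m(1)] by metis
      define p where "p = g (1 / 2)"
      have p: "p \<in> \<alpha> m" "p \<in> upper_half_plane" using g(3,4) by (auto simp: p_def)
      define K' where "K' = (\<Union>m'\<in>M - {m}. \<alpha> m')"
      have cl_K': "closedin riemann_sphere K'"
        unfolding K'_def using finite_M closedin_arc by (intro closedin_Union) auto
      have K'_disj: "K' \<inter> \<alpha> m = {}"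
        using arc_pairs_disjoint[OF m(1)] unfolding K'_def by blast
      have arcs_eq: "upper_arcs = \<alpha> m \<union> K'" unfolding upper_arcs_def K'_def using m(1) by blast
      have m_ext: "m \<subseteq> extended_reals" using arc_ends[OF m(1)] V(1) by blast
      \<comment> \<open>Near \<open>p\<close> the only edge is the arc itself, which lies on the
        cycle and so is missed by \<open>R\<close>. Points of \<open>R\<close> close to
        \<open>p\<close> are therefore off all edges and belong to faces in
        \<open>R\<close>.\<close>
      have "p \<in> cl (\<Union>{f \<in> faces E. f \<subseteq> R})"
        unfolding in_closure_of_riemann_sphere
      proof (intro allI impI)
        fix T assume T: "openin riemann_sphere T \<and> p \<in> T"
        let ?O = "T \<inter> upper_half_plane \<inter> - K'"
        have "openin riemann_sphere ?O"
          using T openin_half_planes(1) cl_K' by (intro openin_Int) (auto simp: openin_Compl_iff_closedin)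
        moreover have "p \<in> ?O" using T p K'_disj by blast
        moreover have "p \<in> cl R" using p(1) m(2) \<gamma>_sub cl_R by blast
        ultimately obtain y where y: "y \<in> R" "y \<in> ?O"
          unfolding in_closure_of_riemann_sphere by blast
        have "y \<notin> \<alpha> m" using y(1) m(2) \<gamma>_sub R_facts(4) by blast
        then have "y \<notin> \<Union>E"
          using y(2) lower_arcs_subset V(1) half_planes_disjoint unfolding Union_E arcs_eq by blast
        then have "{y} \<inter> \<Union>E = {}" by (simp only: Int_insert_left_if0 Int_empty_left not_False_eq_True)
        moreover have "connectedin riemann_sphere {y}" "{y} \<noteq> {}" by simp_all
        ultimately obtain f where f: "f \<in> faces E" "{y} \<subseteq> f" using face_superset by metis
        then have "f \<subseteq> R" using face_in y(1) by blast
        then show "\<Union>{f \<in> faces E. f \<subseteq> R} \<inter> T \<noteq> {}" using f y(2) by blast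
      qed
      \<comment> \<open>For finitely many faces the closure of the union is the union of the
        closures, so a single face touches \<open>p\<close>.\<close>
      then obtain f where f: "f \<in> faces E" "f \<subseteq> R" "p \<in> cl f"
        using finite_faces by (auto simp: closure_of_Union)
      have "curve_image g \<subseteq> cl f"
      proof (rule sphere_arc_frontier_dichotomy[where t = "1 / 2" and q = q
            and K = "extended_reals \<union> K' \<union> reflect ` upper_arcs"])
        show "closedin riemann_sphere (extended_reals \<union> K' \<union> reflect ` upper_arcs)"
          using closedin_extended_reals cl_K' closedin_upper_arcs closedin_reflect
          by (intro closedin_Un) auto
        show "curve_image g \<inter> (extended_reals \<union> K' \<union> reflect ` upper_arcs) \<subseteq> {g 0, g 1}"
          using arc_subset[OF m(1)] K'_disj lower_arcs_subset V(1) half_planes_disjoint g(2,4) by blast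
        show "riemann_sphere frontier_of f \<subseteq> extended_reals \<union> K' \<union> reflect ` upper_arcs \<union> curve_image g"
          using frontier_face[OF f(1)] g(4) unfolding Union_E arcs_eq by blast
        show "f \<inter> (extended_reals \<union> K' \<union> reflect ` upper_arcs \<union> curve_image g) = {}"
          using face_disjoint[OF f(1)] g(4) unfolding Union_E arcs_eq by blast
        \<comment> \<open>The open set \<open>W\<close> accumulates at \<open>p\<close> and misses
          both the arc and \<open>R\<close>, so \<open>f\<close> cannot fill any neighbourhood of
          \<open>p\<close> up to the arc.\<close>
        show "\<not> N - curve_image g \<subseteq> f" if N: "openin riemann_sphere N" "g (1 / 2) \<in> N" for N
        proof -
          have "p \<in> cl W" using p(1) m(2) cl_W by blast
          then obtain y where y: "y \<in> W" "y \<in> N"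
            using N unfolding in_closure_of_riemann_sphere p_def by blast
          then have "y \<notin> curve_image g" using m(2) cl_W g(4) by blast
          moreover have "y \<notin> f" using y(1) WR f(2) by blast
          ultimately show ?thesis using y(2) by blast
        qed
        show "g (1 / 2) \<in> cl f" using f(3) by (simp add: p_def)
        show "Some q \<notin> curve_image g" using q' m(2) g(4) by blast
      qed (use g in auto)
      moreover have mE: "\<alpha> m \<in> E" "reflect ` \<alpha> m \<in> E"
        unfolding E_def using m(1) by blast+
      ultimately have inc: "incident f (\<alpha> m)"
        unfolding g(4)[symmetric] by (intro incidentI[OF f(1)])
      have "f \<in> A" by (rule pos[OF \<gamma> mE(1) m(2) f(1) inc f(2)])
      moreover from this have "reflect ` f \<in> A"
        by (intro pos[OF \<gamma> mE(2) m(3) reflect_face[OF f(1)] incident_reflect[OF inc]] sym[OF f(1) _ f(2)])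
      ultimately show False using alternating_reflect[OF A f(1)] by blast
    qed
  qed
  then obtain f where f: "f \<in> faces E" "f \<in> A" "f \<subseteq> R" "\<not> reflect ` f \<subseteq> R" by blast
  let ?B = "{f \<in> faces E - A. f \<subseteq> R}" and ?A = "{f \<in> faces E \<inter> A. f \<subseteq> R}"
  have "(`) reflect ` ?B \<subset> ?A"
  proof
    show "(`) reflect ` ?B \<subseteq> ?A"
      using B_reflect reflect_face alternating_reflect[OF A] by auto
    have "f \<notin> (`) reflect ` ?B"
    proof
      assume "f \<in> (`) reflect ` ?B"
      then have "reflect ` f \<in> ?B" by auto
      then show False using f(4) by blast
    qed
    then show "(`) reflect ` ?B \<noteq> ?A" using f by blast
  qed
  moreover have "finite ?A" using finite_faces by simp
  ultimately have "card ((`) reflect ` ?B) < card ?A" by (intro psubset_card_mono)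
  moreover have "inj_on ((`) reflect) ?B" by (intro inj_onI) (metis reflect_image_image)
  ultimately show "card ?B < card ?A" by (simp add: card_image)
qed

end

theorem theorem17:
  fixes d :: nat
    and V :: "complex option set"
    and E A :: "complex option set set"
  assumes "generic_real_GB_graph d V E"
    and "alternating_coloring E A"
  shows "locally_balanced E A"
proof -
  from assms(1) obtain M \<alpha> where "2 \<le> d" "V \<subseteq> extended_reals" "finite V" "card V = 2 * d - 2"
    "perfect_matching V M" "\<forall>m\<in>M. upper_arc m (\<alpha> m)" "disjoint_family_on \<alpha> M"
    "E = real_segments V \<union> \<alpha> ` M \<union> (\<lambda>m. reflect ` \<alpha> m) ` M"
    unfolding generic_real_GB_graph_def by blast
  then interpret real_graph V M \<alpha> E
    by unfold_locales auto
  show ?thesis by (rule locally_balanced[OF assms(2)])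
qed

end
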